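(* Let $c\ge1$ be a fixed integer. Given an $n$-vertex split graph $G=(K,I;E)$, an integer $k\ge0$, and $c$-colorable sets $S$ and $S'$ of size at least $k$ in $G$, it can be decided in time $O(n^{c+1})$ whether there is a $\mathsf{TAR}_k$-sequence between $S$ and $S'$.
   Context: A split graph $G=(K,I;E)$ has vertex set partitioned into a clique $K$ and an independent set $I$. A set $S\subseteq V(G)$ is $c$-colorable if $G[S]$ has a proper $c$-coloring. For $c$-colorable sets $S,T$, $S \leftrightarrow T$ under $\mathsf{TAR}_k$ means $|S|,|T|\ge k$ and $|S\triangle T|=1$; a $\mathsf{TAR}_k$-sequence between $S_0$ and $S_\ell$ is a sequence $\langle S_0,\dots,S_\ell\rangle$ of $c$-colorable sets of $G$ with $S_{i-1}\leftrightarrow S_i$ under $\mathsf{TAR}_k$ for all $i$. *)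

theory Defs
  imports Complex_Main "HOL-Library.Landau_Symbols"
begin

section \<open>Reconfiguration of colorable sets in split graphs\<close>

text \<open>
  A finite simple graph is given by its vertex set and its adjacency relation; every
  edge occurs in both orientations.
\<close>

definition split_graph :: "'a set \<Rightarrow> 'a set \<Rightarrow> 'a rel \<Rightarrow> bool" where
  "split_graph K I E \<longleftrightarrow>
     finite (K \<union> I) \<and> K \<inter> I = {} \<and>
     E \<subseteq> (K \<union> I) \<times> (K \<union> I) \<and> sym E \<and> irrefl E \<and>
     (\<forall>u\<in>K. \<forall>v\<in>K. u \<noteq> v \<longrightarrow> (u, v) \<in> E) \<and>
     (\<forall>u\<in>I. \<forall>v\<in>I. (u, v) \<notin> E)"

definition colorable_set :: "nat \<Rightarrow> 'a set \<Rightarrow> 'a rel \<Rightarrow> 'a set \<Rightarrow> bool" where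
  "colorable_set c V E S \<longleftrightarrow>
     S \<subseteq> V \<and>
     (\<exists>f. (\<forall>v\<in>S. f v < c) \<and> (\<forall>u\<in>S. \<forall>v\<in>S. (u, v) \<in> E \<longrightarrow> f u \<noteq> f v))"

definition tar_step :: "nat \<Rightarrow> 'a set \<Rightarrow> 'a set \<Rightarrow> bool" where
  "tar_step k S T \<longleftrightarrow> k \<le> card S \<and> k \<le> card T \<and> card (sym_diff S T) = 1"

text \<open>The one-element sequence is allowed, so every colorable set is reachable from itself.\<close>

definition tar_sequence ::
    "nat \<Rightarrow> nat \<Rightarrow> 'a set \<Rightarrow> 'a rel \<Rightarrow> 'a set \<Rightarrow> 'a set \<Rightarrow> 'a set list \<Rightarrow> bool" where
  "tar_sequence c k V E S S' Ss \<longleftrightarrow>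
     Ss \<noteq> [] \<and> hd Ss = S \<and> last Ss = S' \<and>
     (\<forall>T\<in>set Ss. colorable_set c V E T) \<and> successively (tar_step k) Ss"


section \<open>Word RAM\<close>

text \<open>
  The machine has numbered registers and a random access memory, both holding natural
  numbers. Programs are structured. Subtraction is truncated, division by zero gives
  zero, and \<open>Less\<close> and \<open>Equal\<close> return 1 for true and 0 for false.
\<close>

datatype binop = Add | Sub | Mul | Div | Mod | Less | Equal

fun apply_binop :: "binop \<Rightarrow> nat \<Rightarrow> nat \<Rightarrow> nat" where
  "apply_binop Add x y = x + y"
| "apply_binop Sub x y = x - y"
| "apply_binop Mul x y = x * y"
| "apply_binop Div x y = x div y"
| "apply_binop Mod x y = x mod y"
| "apply_binop Less x y = of_bool (x < y)"
| "apply_binop Equal x y = of_bool (x = y)"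

datatype expr = Const nat | Reg nat | Load expr | Op binop expr expr

text \<open>A state consists of the register contents and the memory contents.\<close>

type_synonym state = "(nat \<Rightarrow> nat) \<times> (nat \<Rightarrow> nat)"

primrec val :: "expr \<Rightarrow> state \<Rightarrow> nat" where
  "val (Const m) \<sigma> = m"
| "val (Reg r) \<sigma> = fst \<sigma> r"
| "val (Load e) \<sigma> = snd \<sigma> (val e \<sigma>)"
| "val (Op f e1 e2) \<sigma> = apply_binop f (val e1 \<sigma>) (val e2 \<sigma>)"

text \<open>Unit cost for every operation of an expression.\<close>

primrec work :: "expr \<Rightarrow> nat" where
  "work (Const m) = 1"
| "work (Reg r) = 1"
| "work (Load e) = work e + 1"
| "work (Op f e1 e2) = work e1 + work e2 + 1"

text \<open>
  All values that occur while evaluating the expression, memory addresses included, are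
  at most \<open>B\<close>, i.e. fit into a machine word.
\<close>

primrec fits :: "nat \<Rightarrow> expr \<Rightarrow> state \<Rightarrow> bool" where
  "fits B (Const m) \<sigma> \<longleftrightarrow> m \<le> B"
| "fits B (Reg r) \<sigma> \<longleftrightarrow> fst \<sigma> r \<le> B"
| "fits B (Load e) \<sigma> \<longleftrightarrow> fits B e \<sigma> \<and> val (Load e) \<sigma> \<le> B"
| "fits B (Op f e1 e2) \<sigma> \<longleftrightarrow> fits B e1 \<sigma> \<and> fits B e2 \<sigma> \<and> val (Op f e1 e2) \<sigma> \<le> B"

datatype com =
    Skip
  | Assign nat expr
  | Store expr expr
  | Seq com com
  | Cond expr com com
  | While expr com

text \<open>
  \<open>exec B p \<sigma> t \<tau>\<close>: started in \<open>\<sigma>\<close>, the program \<open>p\<close> halts after \<open>t\<close> steps in \<open>\<tau>\<close>. There is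
  no rule for a value exceeding \<open>B\<close>: a program that overflows has no execution.
  Conditions are true when nonzero.
\<close>

inductive exec :: "nat \<Rightarrow> com \<Rightarrow> state \<Rightarrow> nat \<Rightarrow> state \<Rightarrow> bool" for B :: nat where
  exec_Skip: "exec B Skip \<sigma> 1 \<sigma>"
| exec_Assign: "fits B e \<sigma> \<Longrightarrow>
    exec B (Assign r e) \<sigma> (work e + 1) ((fst \<sigma>)(r := val e \<sigma>), snd \<sigma>)"
| exec_Store: "fits B a \<sigma> \<Longrightarrow> fits B e \<sigma> \<Longrightarrow>
    exec B (Store a e) \<sigma> (work a + work e + 1) (fst \<sigma>, (snd \<sigma>)(val a \<sigma> := val e \<sigma>))"
| exec_Seq: "exec B p \<sigma> t1 \<rho> \<Longrightarrow> exec B q \<rho> t2 \<tau> \<Longrightarrow> exec B (Seq p q) \<sigma> (t1 + t2) \<tau>"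
| exec_Cond_True: "fits B e \<sigma> \<Longrightarrow> val e \<sigma> \<noteq> 0 \<Longrightarrow> exec B p \<sigma> t \<tau> \<Longrightarrow>
    exec B (Cond e p q) \<sigma> (work e + 1 + t) \<tau>"
| exec_Cond_False: "fits B e \<sigma> \<Longrightarrow> val e \<sigma> = 0 \<Longrightarrow> exec B q \<sigma> t \<tau> \<Longrightarrow>
    exec B (Cond e p q) \<sigma> (work e + 1 + t) \<tau>"
| exec_While_False: "fits B e \<sigma> \<Longrightarrow> val e \<sigma> = 0 \<Longrightarrow>
    exec B (While e p) \<sigma> (work e + 1) \<sigma>"
| exec_While_True: "fits B e \<sigma> \<Longrightarrow> val e \<sigma> \<noteq> 0 \<Longrightarrow>
    exec B p \<sigma> t1 \<rho> \<Longrightarrow> exec B (While e p) \<rho> t2 \<tau> \<Longrightarrow>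
    exec B (While e p) \<sigma> (work e + 1 + t1 + t2) \<tau>"

inductive_cases exec_elims:
  "exec B Skip \<sigma> t \<tau>" "exec B (Assign r e) \<sigma> t \<tau>" "exec B (Store a e) \<sigma> t \<tau>"
  "exec B (Seq p q) \<sigma> t \<tau>" "exec B (Cond e p q) \<sigma> t \<tau>" "exec B (While e p) \<sigma> t \<tau>"

lemma exec_deterministic:
  "exec B p \<sigma> t \<tau> \<Longrightarrow> exec B p \<sigma> t' \<tau>' \<Longrightarrow> t' = t \<and> \<tau>' = \<tau>"
proof (induction arbitrary: t' \<tau>' rule: exec.induct)
  case (exec_Skip \<sigma>)
  then show ?case by (rule exec_elims(1)) simp
next
  case (exec_Assign e \<sigma> r)
  from exec_Assign.prems show ?case by (rule exec_elims(2)) simp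
next
  case (exec_Store a \<sigma> e)
  from exec_Store.prems show ?case by (rule exec_elims(3)) simp
next
  case (exec_Seq p \<sigma> t1 \<rho> q t2 \<tau>)
  from exec_Seq.prems show ?case by (rule exec_elims(4)) (metis exec_Seq.IH)
next
  case (exec_Cond_True e \<sigma> p t \<tau> q)
  from exec_Cond_True.prems show ?case
    by (rule exec_elims(5)) (simp, metis exec_Cond_True.IH, use exec_Cond_True.hyps(2) in simp)
next
  case (exec_Cond_False e \<sigma> q t \<tau> p)
  from exec_Cond_False.prems show ?case
    by (rule exec_elims(5)) (use exec_Cond_False.hyps(2) in simp, simp, metis exec_Cond_False.IH)
next
  case (exec_While_False e \<sigma> p)
  from exec_While_False.prems show ?case
    by (rule exec_elims(6)) (use exec_While_False.hyps in simp_all)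
next
  case (exec_While_True e \<sigma> p t1 \<rho> t2 \<tau>)
  from exec_While_True.prems show ?case
    by (rule exec_elims(6)) (use exec_While_True.hyps(2) in simp, simp, metis exec_While_True.IH)
qed

text \<open>
  The input words are placed in memory from address 0 on; all other memory cells and all
  registers are initially zero. The answer is left in register 0.
\<close>

definition initial_state :: "nat list \<Rightarrow> state" where
  "initial_state ws = (\<lambda>r. 0, \<lambda>a. if a < length ws then ws ! a else 0)"

definition answers_within :: "nat \<Rightarrow> com \<Rightarrow> nat list \<Rightarrow> nat \<Rightarrow> bool \<Rightarrow> bool" where
  "answers_within B p ws T b \<longleftrightarrow>
     (\<exists>t \<tau>. exec B p (initial_state ws) t \<tau> \<and> t \<le> T \<and> fst \<tau> 0 = of_bool b)"


section \<open>Encoding of instances\<close>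

text \<open>
  The vertices are \<open>0, \<dots>, n - 1\<close>. The input consists of \<open>n\<close>, \<open>k\<close>, the characteristic
  vectors of \<open>K\<close>, \<open>S\<close> and \<open>S'\<close>, and the adjacency matrix, row by row; \<open>I\<close> is the
  complement of \<open>K\<close>.
\<close>

definition encode_instance ::
    "nat \<Rightarrow> nat \<Rightarrow> nat set \<Rightarrow> nat rel \<Rightarrow> nat set \<Rightarrow> nat set \<Rightarrow> nat list" where
  "encode_instance n k K E S S' =
     [n, k] @
     map (\<lambda>v. of_bool (v \<in> K)) [0..<n] @
     map (\<lambda>v. of_bool (v \<in> S)) [0..<n] @
     map (\<lambda>v. of_bool (v \<in> S')) [0..<n] @
     map (\<lambda>e. of_bool (e \<in> E)) (List.product [0..<n] [0..<n])"

end

theory Submission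
  imports Defs
begin

text \<open>
  A set is \<open>c\<close>-colorable iff it has at most \<open>c\<close> vertices in \<open>K\<close> and no vertex of \<open>I\<close> sees \<open>c\<close> of
  them. So the colorable sets with clique part \<open>X\<close> have a largest element \<open>fill X\<close>, and those of
  size at least \<open>k\<close> are all connected to it. A step that changes the clique part between \<open>X\<close> and
  \<open>X - {v}\<close> is possible iff \<open>fill X\<close> has more than \<open>k\<close> elements. It remains to search the graph of
  the sets \<open>X\<close>. They are represented by the \<open>(n + 1) ^ c\<close> strings of \<open>c\<close> digits in base \<open>n + 1\<close>,
  where digits outside \<open>K\<close> are blanks. A repeated digit can only decrease the
  computed size of \<open>fill X\<close>, which removes edges but never creates false ones, and every move has
  a representation without repetitions; hence repetitions need not be detected. Computing one size
  and expanding one node both take time \<open>O(n)\<close>.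
\<close>

subsection \<open>Colorable sets of a split graph\<close>

locale split_reconf =
  fixes c k :: nat and K I :: "'a set" and E :: "'a rel"
  assumes split: "split_graph K I E" and c_pos: "1 \<le> c"
begin

abbreviation colorable :: "'a set \<Rightarrow> bool" where
  "colorable \<equiv> colorable_set c (K \<union> I) E"

definition move :: "'a set \<Rightarrow> 'a set \<Rightarrow> bool" where
  "move S T \<longleftrightarrow> colorable S \<and> colorable T \<and> tar_step k S T"

text \<open>The largest colorable set whose clique part is \<open>X\<close>, provided that \<open>card X \<le> c\<close>.\<close>

definition fill :: "'a set \<Rightarrow> 'a set" where
  "fill X = X \<union> {v \<in> I. card X = c \<longrightarrow> (\<exists>u\<in>X. (u, v) \<notin> E)}"

lemma finite_K: "finite K" and finite_I: "finite I" and disjoint: "K \<inter> I = {}"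
  and E_subset: "E \<subseteq> (K \<union> I) \<times> (K \<union> I)" and E_sym: "sym E"
  and K_clique: "u \<in> K \<Longrightarrow> v \<in> K \<Longrightarrow> u \<noteq> v \<Longrightarrow> (u, v) \<in> E"
  and I_independent: "u \<in> I \<Longrightarrow> v \<in> I \<Longrightarrow> (u, v) \<notin> E"
  and E_irrefl: "(u, u) \<notin> E"
  using split by (auto simp: split_graph_def irrefl_def)

section \<open>Colorability in terms of the clique part\<close>

lemma finite_colorable: "colorable S \<Longrightarrow> finite S"
  using finite_K finite_I by (auto simp: colorable_set_def intro: finite_subset)

lemma colorable_mono:
  assumes "colorable T" "S \<subseteq> T"
  shows "colorable S"
proof -
  obtain f where "\<forall>v\<in>T. f v < c" "\<forall>u\<in>T. \<forall>v\<in>T. (u, v) \<in> E \<longrightarrow> f u \<noteq> f v" "T \<subseteq> K \<union> I"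
    using assms(1) by (auto simp: colorable_set_def)
  then show ?thesis
    using assms(2) unfolding colorable_set_def by (intro conjI exI[of _ f]) (auto simp: subset_iff)
qed

text \<open>A proper coloring is injective on pairwise adjacent vertices.\<close>

lemma card_clique_le:
  assumes "colorable S" "Q \<subseteq> S" "\<And>u v. u \<in> Q \<Longrightarrow> v \<in> Q \<Longrightarrow> u \<noteq> v \<Longrightarrow> (u, v) \<in> E"
  shows "card Q \<le> c"
proof -
  obtain f where f: "\<forall>v\<in>S. f v < c" "\<forall>u\<in>S. \<forall>v\<in>S. (u, v) \<in> E \<longrightarrow> f u \<noteq> f v"
    using assms(1) by (auto simp: colorable_set_def)
  have "inj_on f Q"
    using assms f by (meson inj_onI subsetD)
  moreover have "f ` Q \<subseteq> {..<c}"
    using assms f by blast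
  ultimately show ?thesis
    using card_inj_on_le[of f Q "{..<c}"] by simp
qed

lemma card_clique_part_le: "colorable S \<Longrightarrow> card (S \<inter> K) \<le> c"
  by (rule card_clique_le[of S]) (auto intro: K_clique)

text \<open>If a vertex of \<open>S\<close> in \<open>I\<close> saw all of \<open>c\<close> clique
  vertices of \<open>S\<close>, it would form with them a clique of size
  \<open>c + 1\<close>.\<close>

lemma colorable_subset_fill:
  assumes "colorable S"
  shows "S \<subseteq> fill (S \<inter> K)"
proof
  fix v assume v: "v \<in> S"
  show "v \<in> fill (S \<inter> K)"
  proof (cases "v \<in> K")
    case False
    with v assms have "v \<in> I"
      by (auto simp: colorable_set_def)
    moreover have False if "card (S \<inter> K) = c" "\<forall>u\<in>S \<inter> K. (u, v) \<in> E"
    proof -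
      have "card (insert v (S \<inter> K)) \<le> c"
        using assms v that(2) E_sym
        by (intro card_clique_le[OF assms]) (auto intro: K_clique dest: symD)
      with False finite_K that(1) show False
        by simp
    qed
    ultimately show ?thesis
      by (auto simp: fill_def)
  qed (use v in \<open>auto simp: fill_def\<close>)
qed

lemma colorable_fill:
  assumes X: "X \<subseteq> K" "card X \<le> c"
  shows "colorable (fill X)"
proof -
  have "finite X"
    using X finite_K finite_subset by blast
  then obtain g where g: "bij_betw g X {0..<card X}"
    using ex_bij_betw_finite_nat by blast
  have inj: "g u \<noteq> g v" if "u \<in> X" "v \<in> X" "u \<noteq> v" for u v
    using g that by (auto simp: bij_betw_def inj_on_def)
  have lt: "g u < card X" if "u \<in> X" for u
    using g that by (auto simp: bij_betw_def)
  define h where "h v = (SOME u. u \<in> X \<and> (u, v) \<notin> E)" for v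
  have h: "h v \<in> X \<and> (h v, v) \<notin> E" if "\<exists>u\<in>X. (u, v) \<notin> E" for v
    unfolding h_def by (rule someI_ex) (use that in blast)
  text \<open>With fewer than \<open>c\<close> clique vertices the last color is free; otherwise reuse the color of a
    non-neighbour.\<close>
  define f where "f v = (if v \<in> X then g v else if card X = c then g (h v) else c - 1)" for v
  have "f v < c" if "v \<in> fill X" for v
    using that lt[of v] lt[of "h v"] h[of v] X c_pos by (auto simp: f_def fill_def)
  \<comment> \<open>As \<open>I\<close> is independent, every edge inside \<open>fill X\<close> has
    an end in \<open>X\<close>; by symmetry this case settles all edges.\<close>
  moreover have ne: "f u \<noteq> f v" if "u \<in> X" "v \<in> fill X" "(u, v) \<in> E" for u v
  proof (cases "v \<in> X")
    case True
    then show ?thesis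
      using that inj E_irrefl by (auto simp: f_def)
  next
    case False
    then show ?thesis
      using that h[of v] inj[of u "h v"] lt[of u] X(2)
      by (auto simp: f_def fill_def)
  qed
  moreover have "f u \<noteq> f v" if "u \<in> fill X" "v \<in> fill X" "(u, v) \<in> E" for u v
  proof (cases "u \<in> X")
    case False
    then have "v \<in> X"
      using that I_independent by (auto simp: fill_def)
    then show ?thesis
      using ne[of v u] that E_sym by (metis symD)
  qed (use ne that in blast)
  moreover have "fill X \<subseteq> K \<union> I"
    using X by (auto simp: fill_def)
  ultimately show ?thesis
    unfolding colorable_set_def by (intro conjI exI[of _ f] ballI impI) auto
qed

lemma finite_fill: "X \<subseteq> K \<Longrightarrow> finite (fill X)"
  using finite_K finite_I by (auto simp: fill_def intro: finite_subset)

section \<open>Connectivity under moves\<close>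

lemma move_sym: "move S T \<Longrightarrow> move T S"
  by (auto simp: move_def tar_step_def Un_commute)

lemma connected_sym: "move\<^sup>*\<^sup>* S T \<Longrightarrow> move\<^sup>*\<^sup>* T S"
  by (induction rule: rtranclp_induct) (auto intro: converse_rtranclp_into_rtranclp move_sym)

text \<open>The vertices of \<open>T - S\<close> are added one at a time. Sizes only grow, and all
  intermediate sets are subsets of the colorable set \<open>T\<close>.\<close>

lemma connected_subset:
  assumes "S \<subseteq> T" "colorable T" "k \<le> card S"
  shows "move\<^sup>*\<^sup>* S T"
proof -
  have fin: "finite S"
    using assms finite_colorable finite_subset by blast
  have "finite (T - S)"
    using assms finite_colorable by blast
  have "S \<union> D \<subseteq> T \<Longrightarrow> move\<^sup>*\<^sup>* S (S \<union> D)" if "D \<inter> S = {}" "finite D" for D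
    using that(2,1)
  proof (induction D rule: finite_induct)
    case (insert v D)
    have "sym_diff (S \<union> D) (S \<union> insert v D) = {v}"
      using insert by auto
    moreover have "card S \<le> card (S \<union> D)" "card S \<le> card (S \<union> insert v D)"
      using fin insert.hyps by (auto intro!: card_mono)
    ultimately have "move (S \<union> D) (S \<union> insert v D)"
      using assms(3) insert.prems
      by (auto simp: move_def tar_step_def intro!: colorable_mono[OF assms(2)])
    with insert show ?case
      by (auto intro: rtranclp.rtrancl_into_rtrancl)
  qed simp
  from this[of "T - S"] show ?thesis
    using assms(1) \<open>finite (T - S)\<close> by (auto simp: Un_absorb1)
qed

lemma connected_fill:
  assumes "colorable S" "k \<le> card S"
  shows "move\<^sup>*\<^sup>* S (fill (S \<inter> K))"
  using assms by (intro connected_subset colorable_subset_fill colorable_fill card_clique_part_le) auto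

text \<open>The route goes down from \<open>fill X\<close> to a common subset \<open>Z\<close> and
  up again to \<open>fill Y\<close>. \<open>Z\<close> lacks at most \<open>v\<close>, so it still
  has \<open>k\<close> elements. The case \<open>X = Y\<close> is included because overwriting a
  repeated or blank digit of a code need not change the set.\<close>

lemma connected_fill_remove:
  assumes X: "Y \<subseteq> X" "X \<subseteq> insert v Y" "X \<subseteq> K" "card X \<le> c" and k: "k < card (fill X)"
  shows "k \<le> card (fill Y) \<and> move\<^sup>*\<^sup>* (fill X) (fill Y)"
proof -
  define Z where "Z = Y \<union> (fill X \<inter> I)"
  have fin: "finite X"
    using X finite_K finite_subset by blast
  have ZX: "Z \<subseteq> fill X"
    using X by (auto simp: Z_def fill_def)
  \<comment> \<open>Only for \<open>card Y = c\<close> does \<open>fill Y\<close> restrict the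
    vertices of \<open>I\<close>, and then \<open>X\<close> and \<open>Y\<close> coincide.\<close>
  have "X = Y" if "card Y = c"
    using that X fin by (metis card_mono card_subset_eq order_antisym)
  then have ZY: "Z \<subseteq> fill Y"
    using X(3) disjoint by (auto simp: Z_def fill_def)
  have "finite Z"
    using ZX finite_fill[OF X(3)] finite_subset by blast
  moreover have "fill X \<subseteq> insert v Z"
    using X(2) by (auto simp: Z_def fill_def)
  ultimately have "card (fill X) \<le> card (insert v Z)"
    by (intro card_mono) auto
  also have "\<dots> \<le> Suc (card Z)"
    using \<open>finite Z\<close> by (simp add: card_insert_if)
  finally have kZ: "k \<le> card Z"
    using k by simp
  have Y: "Y \<subseteq> K" "card Y \<le> c"
    using X fin card_mono[of X Y] by auto
  have "move\<^sup>*\<^sup>* Z (fill X)" "move\<^sup>*\<^sup>* Z (fill Y)"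
    using ZX ZY kZ X Y by (auto intro!: connected_subset colorable_fill)
  moreover have "card Z \<le> card (fill Y)"
    using ZY finite_fill[OF Y(1)] by (rule card_mono[rotated])
  ultimately show ?thesis
    using kZ connected_sym rtranclp_trans by (metis order_trans)
qed

text \<open>Colorability of \<open>S\<close> matters for the path of length zero, about which
  \<open>move\<close> says nothing, while the one-element sequence must consist of a colorable
  set.\<close>

lemma tar_sequence_iff_connected:
  assumes "colorable S"
  shows "(\<exists>Ss. tar_sequence c k (K \<union> I) E S S' Ss) \<longleftrightarrow> move\<^sup>*\<^sup>* S S'"
proof
  assume "\<exists>Ss. tar_sequence c k (K \<union> I) E S S' Ss"
  then obtain Ss where "tar_sequence c k (K \<union> I) E S S' Ss"
    by blast
  then show "move\<^sup>*\<^sup>* S S'"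
  proof (induction Ss arbitrary: S)
    case (Cons T Ss)
    show ?case
    proof (cases Ss)
      case Nil
      then show ?thesis
        using Cons.prems by (auto simp: tar_sequence_def)
    next
      case (Cons U Us)
      then have "tar_sequence c k (K \<union> I) E U S' Ss" "move S U"
        using Cons.prems by (auto simp: tar_sequence_def move_def)
      then show ?thesis
        using Cons.IH by (meson converse_rtranclp_into_rtranclp)
    qed
  qed (simp add: tar_sequence_def)
next
  assume "move\<^sup>*\<^sup>* S S'"
  then show "\<exists>Ss. tar_sequence c k (K \<union> I) E S S' Ss"
  proof (induction rule: rtranclp_induct)
    case base
    have "tar_sequence c k (K \<union> I) E S S [S]"
      using assms by (simp add: tar_sequence_def)
    then show ?case ..
  next
    case (step T U)
    then obtain Ss where "tar_sequence c k (K \<union> I) E S T Ss"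
      by blast
    then have "tar_sequence c k (K \<union> I) E S U (Ss @ [U])"
      using step.hyps by (auto simp: tar_sequence_def move_def successively_append_iff)
    then show ?case ..
  qed
qed

end


subsection \<open>Loop-free programs\<close>

fun loop_free :: "com \<Rightarrow> bool" where
  "loop_free (Seq p q) \<longleftrightarrow> loop_free p \<and> loop_free q"
| "loop_free (Cond e p q) \<longleftrightarrow> loop_free p \<and> loop_free q"
| "loop_free (While e p) \<longleftrightarrow> False"
| "loop_free _ \<longleftrightarrow> True"

text \<open>A functional semantics, so that the effect of a loop-free program can be computed by
  rewriting. The value for \<open>While\<close> is a dummy.\<close>

fun sem :: "com \<Rightarrow> state \<Rightarrow> state" where
  "sem Skip \<sigma> = \<sigma>"
| "sem (Assign r e) \<sigma> = ((fst \<sigma>)(r := val e \<sigma>), snd \<sigma>)"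
| "sem (Store a e) \<sigma> = (fst \<sigma>, (snd \<sigma>)(val a \<sigma> := val e \<sigma>))"
| "sem (Seq p q) \<sigma> = sem q (sem p \<sigma>)"
| "sem (Cond e p q) \<sigma> = (if val e \<sigma> \<noteq> 0 then sem p \<sigma> else sem q \<sigma>)"
| "sem (While e p) \<sigma> = undefined"

text \<open>A bound for the running time of loop-free programs only: the body of a loop counts once.\<close>

primrec cost :: "com \<Rightarrow> nat" where
  "cost Skip = 1"
| "cost (Assign r e) = work e + 1"
| "cost (Store a e) = work a + work e + 1"
| "cost (Seq p q) = cost p + cost q"
| "cost (Cond e p q) = work e + 1 + cost p + cost q"
| "cost (While e p) = work e + 1 + cost p"

primrec consts_le :: "nat \<Rightarrow> expr \<Rightarrow> bool" where
  "consts_le X (Const m) \<longleftrightarrow> m \<le> X"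
| "consts_le X (Reg r) \<longleftrightarrow> True"
| "consts_le X (Load e) \<longleftrightarrow> consts_le X e"
| "consts_le X (Op f e1 e2) \<longleftrightarrow> consts_le X e1 \<and> consts_le X e2"

primrec prog_consts_le :: "nat \<Rightarrow> com \<Rightarrow> bool" where
  "prog_consts_le X Skip \<longleftrightarrow> True"
| "prog_consts_le X (Assign r e) \<longleftrightarrow> consts_le X e"
| "prog_consts_le X (Store a e) \<longleftrightarrow> consts_le X a \<and> consts_le X e"
| "prog_consts_le X (Seq p q) \<longleftrightarrow> prog_consts_le X p \<and> prog_consts_le X q"
| "prog_consts_le X (Cond e p q) \<longleftrightarrow> consts_le X e \<and> prog_consts_le X p \<and> prog_consts_le X q"
| "prog_consts_le X (While e p) \<longleftrightarrow> consts_le X e \<and> prog_consts_le X p"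

definition bounded :: "nat \<Rightarrow> state \<Rightarrow> bool" where
  "bounded X \<sigma> \<longleftrightarrow> (\<forall>r. fst \<sigma> r \<le> X) \<and> (\<forall>a. snd \<sigma> a \<le> X)"

text \<open>Only the written values are restricted to \<open>X\<close>. Intermediate values of
  expressions may be larger and are controlled by a power of \<open>X\<close>.\<close>

fun stores_le :: "nat \<Rightarrow> com \<Rightarrow> state \<Rightarrow> bool" where
  "stores_le X (Assign r e) \<sigma> \<longleftrightarrow> val e \<sigma> \<le> X"
| "stores_le X (Store a e) \<sigma> \<longleftrightarrow> val e \<sigma> \<le> X"
| "stores_le X (Seq p q) \<sigma> \<longleftrightarrow> stores_le X p \<sigma> \<and> stores_le X q (sem p \<sigma>)"
| "stores_le X (Cond e p q) \<sigma> \<longleftrightarrow> (if val e \<sigma> \<noteq> 0 then stores_le X p \<sigma> else stores_le X q \<sigma>)"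
| "stores_le X _ \<sigma> \<longleftrightarrow> True"

section \<open>Word sizes sufficient for loop-free programs\<close>

lemma work_pos: "0 < work e"
  by (cases e) auto

text \<open>Every operation yields at most the product of the bounds for its operands: a sum is
  below the product because both bounds are at least 2. Exponents therefore add up just as
  \<open>work\<close> does.\<close>

lemma val_le_power:
  assumes "bounded X \<sigma>" "2 \<le> X" "consts_le X e"
  shows "val e \<sigma> \<le> X ^ work e"
  using assms(3)
proof (induction e)
  case (Load e)
  have "snd \<sigma> (val e \<sigma>) \<le> X ^ 1"
    using assms(1) by (simp add: bounded_def)
  also have "\<dots> \<le> X ^ (work e + 1)"
    using assms(2) by (intro power_increasing) auto
  finally show ?case
    by simp
next
  case (Op f e1 e2)
  define a b where "a = X ^ work e1" and "b = X ^ work e2"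
  have ge: "2 \<le> a" "2 \<le> b"
    using self_le_power[of X "work e1"] self_le_power[of X "work e2"] work_pos[of e1] work_pos[of e2]
      assms(2) by (auto simp: a_def b_def)
  have IH: "val e1 \<sigma> \<le> a" "val e2 \<sigma> \<le> b"
    using Op by (auto simp: a_def b_def)
  have ab: "a + b \<le> a * b"
  proof -
    obtain a' b' where "a = a' + 2" "b = b' + 2"
      using ge by (metis add.commute le_Suc_ex)
    then show ?thesis
      by (simp add: algebra_simps)
  qed
  have "apply_binop f (val e1 \<sigma>) (val e2 \<sigma>) \<le> a * b"
  proof (cases f)
    case Div
    have "val e1 \<sigma> div val e2 \<sigma> \<le> val e1 \<sigma>"
      by simp
    also have "\<dots> \<le> a * b"
      using IH ab by simp
    finally show ?thesis
      using Div by simp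
  next
    case Mod
    have "val e1 \<sigma> mod val e2 \<sigma> \<le> val e1 \<sigma>"
      by simp
    also have "\<dots> \<le> a * b"
      using IH ab by simp
    finally show ?thesis
      using Mod by simp
  qed (use IH ab ge in \<open>auto intro: mult_le_mono order_trans\<close>)
  also have "\<dots> \<le> a * b * X"
    using assms(2) by simp
  finally show ?case
    by (simp add: a_def b_def power_add mult_ac)
qed (use assms in \<open>auto simp: bounded_def\<close>)

lemma fits_if_bounded:
  assumes "bounded X \<sigma>" "2 \<le> X" "consts_le X e" "X ^ work e \<le> B"
  shows "fits B e \<sigma>"
  using assms(3,4)
proof (induction e)
  case (Load e)
  have "X ^ work e \<le> X ^ work (Load e)"
    using assms(2) by (intro power_increasing) auto
  then have "X ^ work e \<le> B"
    using Load.prems(2) by (rule order_trans)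
  then show ?case
    using Load val_le_power[OF assms(1,2) Load.prems(1)] by simp
next
  case (Op f e1 e2)
  have "X ^ work e1 \<le> X ^ work (Op f e1 e2)" "X ^ work e2 \<le> X ^ work (Op f e1 e2)"
    using assms(2) by (simp_all del: power_Suc)
  then show ?case
    using Op val_le_power[OF assms(1,2) Op.prems(1)] by (auto intro: order_trans)
qed (use assms in \<open>auto simp: bounded_def intro: order_trans\<close>)

text \<open>No expression in \<open>p\<close> has more work than \<open>cost p\<close>, so words up
  to \<open>X ^ cost p\<close> never overflow. What remains to be checked for a concrete program is
  \<open>stores_le\<close>.\<close>

lemma exec_loop_free:
  assumes "2 \<le> X" and "loop_free p" "bounded X \<sigma>" "prog_consts_le X p" "X ^ cost p \<le> B" "stores_le X p \<sigma>"
  shows "\<exists>t. exec B p \<sigma> t (sem p \<sigma>) \<and> t \<le> cost p \<and> bounded X (sem p \<sigma>)"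
  using assms(2-)
proof (induction p arbitrary: \<sigma>)
  case Skip
  then show ?case
    using exec_Skip[of B \<sigma>] by (intro exI[of _ 1]) simp
next
  case (Assign r e)
  have "X ^ work e \<le> X ^ cost (Assign r e)"
    using assms(1) by (intro power_increasing) auto
  then have "X ^ work e \<le> B"
    using Assign.prems(4) by (rule order_trans)
  then have "fits B e \<sigma>"
    using Assign assms(1) by (intro fits_if_bounded) auto
  then show ?case
    using Assign exec_Assign[of B e \<sigma> r] by (auto simp: bounded_def)
next
  case (Store a e)
  have "X ^ work e \<le> X ^ cost (Store a e)" "X ^ work a \<le> X ^ cost (Store a e)"
    using assms(1) by (simp_all del: power_Suc)
  then have "fits B a \<sigma>" "fits B e \<sigma>"
    using Store assms(1) by (auto intro!: fits_if_bounded)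
  then show ?case
    using Store exec_Store[of B a \<sigma> e] by (auto simp: bounded_def)
next
  case (Seq p q)
  have "X ^ cost p \<le> X ^ cost (Seq p q)" "X ^ cost q \<le> X ^ cost (Seq p q)"
    using assms(1) by (simp_all del: power_Suc)
  then have le: "X ^ cost p \<le> B" "X ^ cost q \<le> B"
    using Seq.prems by (auto intro: order_trans)
  obtain t1 where 1: "exec B p \<sigma> t1 (sem p \<sigma>)" "t1 \<le> cost p" "bounded X (sem p \<sigma>)"
    using Seq le by fastforce
  obtain t2 where "exec B q (sem p \<sigma>) t2 (sem q (sem p \<sigma>))" "t2 \<le> cost q"
      "bounded X (sem q (sem p \<sigma>))"
    using Seq.IH(2)[of "sem p \<sigma>"] Seq.prems le 1 by auto
  with 1 show ?case
    by (auto intro!: exI[of _ "t1 + t2"] exec_Seq)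
next
  case (Cond e p q)
  have "X ^ cost p \<le> X ^ cost (Cond e p q)" "X ^ cost q \<le> X ^ cost (Cond e p q)"
    "X ^ work e \<le> X ^ cost (Cond e p q)"
    using assms(1) by (simp_all del: power_Suc)
  then have le: "X ^ cost p \<le> B" "X ^ cost q \<le> B" "X ^ work e \<le> B"
    using Cond.prems by (auto intro: order_trans)
  have fits: "fits B e \<sigma>"
    using Cond.prems assms(1) le by (intro fits_if_bounded) auto
  show ?case
  proof (cases "val e \<sigma> = 0")
    case True
    obtain t where "exec B q \<sigma> t (sem q \<sigma>)" "t \<le> cost q" "bounded X (sem q \<sigma>)"
      using Cond.IH(2)[of \<sigma>] Cond.prems le True by auto
    with True fits show ?thesis
      by (auto intro!: exI[of _ "work e + 1 + t"] exec_Cond_False)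
  next
    case False
    obtain t where "exec B p \<sigma> t (sem p \<sigma>)" "t \<le> cost p" "bounded X (sem p \<sigma>)"
      using Cond.IH(1)[of \<sigma>] Cond.prems le False by auto
    with False fits show ?thesis
      by (auto intro!: exI[of _ "work e + 1 + t"] exec_Cond_True)
  qed
qed auto


subsection \<open>Programs with loops\<close>

text \<open>A total correctness triple with a time bound.\<close>

definition runs :: "nat \<Rightarrow> com \<Rightarrow> state \<Rightarrow> nat \<Rightarrow> (state \<Rightarrow> bool) \<Rightarrow> bool" where
  "runs B p \<sigma> T Q \<longleftrightarrow> (\<exists>t \<tau>. exec B p \<sigma> t \<tau> \<and> t \<le> T \<and> Q \<tau>)"

lemma runs_mono: "runs B p \<sigma> T Q \<Longrightarrow> T \<le> T' \<Longrightarrow> (\<And>\<tau>. Q \<tau> \<Longrightarrow> Q' \<tau>) \<Longrightarrow> runs B p \<sigma> T' Q'"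
  unfolding runs_def by (meson order_trans)

lemma runs_Seq:
  assumes "runs B p \<sigma> T1 Q" "\<And>\<rho>. Q \<rho> \<Longrightarrow> runs B q \<rho> T2 R"
  shows "runs B (Seq p q) \<sigma> (T1 + T2) R"
  using assms unfolding runs_def by (meson add_mono exec_Seq)

lemma runs_loop_free:
  assumes "2 \<le> X" "loop_free p" "bounded X \<sigma>" "prog_consts_le X p" "X ^ cost p \<le> B"
    "stores_le X p \<sigma>" "bounded X (sem p \<sigma>) \<Longrightarrow> Q (sem p \<sigma>)"
  shows "runs B p \<sigma> (cost p) Q"
  using exec_loop_free[OF assms(1-6)] assms(7) unfolding runs_def by blast

text \<open>The variant \<open>\<mu>\<close> bounds the number of iterations; the last summand pays
  for the final, failing test.\<close>

lemma runs_While: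
  assumes fits: "\<And>\<sigma>. J \<sigma> \<Longrightarrow> fits B e \<sigma>"
    and body: "\<And>\<sigma>. J \<sigma> \<Longrightarrow> val e \<sigma> \<noteq> 0 \<Longrightarrow> runs B p \<sigma> T (\<lambda>\<tau>. J \<tau> \<and> \<mu> \<tau> < \<mu> \<sigma>)"
    and "J \<sigma>"
  shows "runs B (While e p) \<sigma> (\<mu> \<sigma> * (work e + 1 + T) + (work e + 1)) (\<lambda>\<tau>. J \<tau> \<and> val e \<tau> = 0)"
  using \<open>J \<sigma>\<close>
proof (induction "\<mu> \<sigma>" arbitrary: \<sigma> rule: less_induct)
  case less
  show ?case
  proof (cases "val e \<sigma> = 0")
    case True
    then show ?thesis
      using exec_While_False[OF fits[OF less.prems]] less.prems unfolding runs_def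
      by (intro exI[of _ "work e + 1"] exI[of _ \<sigma>]) auto
  next
    case False
    obtain t1 \<rho> where 1: "exec B p \<sigma> t1 \<rho>" "t1 \<le> T" "J \<rho>" "\<mu> \<rho> < \<mu> \<sigma>"
      using body[OF less.prems False] by (auto simp: runs_def)
    obtain t2 \<tau> where 2: "exec B (While e p) \<rho> t2 \<tau>" "J \<tau>" "val e \<tau> = 0"
        "t2 \<le> \<mu> \<rho> * (work e + 1 + T) + (work e + 1)"
      using less.hyps[OF 1(4,3)] by (auto simp: runs_def)
    have "Suc (\<mu> \<rho>) * (work e + 1 + T) \<le> \<mu> \<sigma> * (work e + 1 + T)"
      using 1(4) by (intro mult_le_mono1) simp
    then have "work e + 1 + t1 + t2 \<le> \<mu> \<sigma> * (work e + 1 + T) + (work e + 1)"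
      using 1(2) 2(4) by simp
    then show ?thesis
      using exec_While_True[OF fits[OF less.prems] False 1(1) 2(1)] 2 unfolding runs_def by blast
  qed
qed


subsection \<open>Positional notation\<close>

definition digit :: "nat \<Rightarrow> nat \<Rightarrow> nat \<Rightarrow> nat" where
  "digit m x i = x div m ^ i mod m"

text \<open>This is the form in which the machine computes it. The truncated subtraction is exact,
  since a digit times its place value never exceeds the number.\<close>

definition set_digit :: "nat \<Rightarrow> nat \<Rightarrow> nat \<Rightarrow> nat \<Rightarrow> nat" where
  "set_digit m x i w = x - digit m x i * m ^ i + w * m ^ i"

lemma digit_less: "0 < m \<Longrightarrow> digit m x i < m"
  by (simp add: digit_def)

lemma digit_0 [simp]: "digit m x 0 = x mod m"
  by (simp add: digit_def)

lemma digit_Suc: "digit m x (Suc i) = digit m (x div m) i"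
  by (simp add: digit_def div_mult2_eq)

lemma digit_mult_power_le: "digit m x i * m ^ i \<le> x"
proof -
  have "digit m x i * m ^ i \<le> x div m ^ i * m ^ i"
    unfolding digit_def by (intro mult_le_mono1) simp
  also have "\<dots> \<le> x"
    by simp
  finally show ?thesis .
qed

lemma set_digit_0: "set_digit m x 0 w = x div m * m + w"
  by (simp add: set_digit_def minus_mod_eq_div_mult)

text \<open>Splitting off the lowest digit makes the later facts on \<open>set_digit\<close>
  provable by induction on the position or on the number of digits.\<close>

lemma set_digit_Suc: "set_digit m x (Suc i) w = set_digit m (x div m) i w * m + x mod m"
proof -
  \<comment> \<open>An additive form of the claim for \<open>x div m\<close>, which avoids truncated
    subtraction.\<close>
  have "set_digit m (x div m) i w * m + digit m (x div m) i * m ^ i * m = (x div m + w * m ^ i) * m"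
    using digit_mult_power_le[of m "x div m" i]
    by (simp add: set_digit_def flip: add_mult_distrib)
  moreover have "x div m * m + x mod m = x"
    by simp
  ultimately show ?thesis
    using digit_mult_power_le[of m x "Suc i"]
    by (simp add: set_digit_def[of m x] digit_Suc algebra_simps)
      (use mult_div_mod_eq[of m x] in linarith)
qed

lemma digit_set_digit:
  assumes "w < m"
  shows "digit m (set_digit m x i w) j = (if j = i then w else digit m x j)"
proof (induction i arbitrary: x j)
  case 0
  then show ?case
    using assms by (cases j) (auto simp: set_digit_0 digit_Suc)
next
  case (Suc i)
  then show ?case
    using assms by (cases j) (auto simp: set_digit_Suc digit_Suc)
qed

lemma set_digit_less:
  assumes "x < m ^ c" "i < c" "w < m"
  shows "set_digit m x i w < m ^ c"
  using assms
proof (induction c arbitrary: x i)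
  case (Suc c)
  have "x div m < m ^ c"
    using Suc.prems by (simp add: less_mult_imp_div_less mult.commute)
  moreover have "set_digit m x i w div m < m ^ c"
    using Suc.prems calculation Suc.IH[of "x div m" "i - 1"]
    by (cases i) (auto simp: set_digit_0 set_digit_Suc)
  ultimately show ?case
    using Suc.prems(3) div_less_iff_less_mult[of m "set_digit m x i w" "m ^ c"]
    by (simp add: mult.commute)
qed simp

lemma ex_digits:
  assumes "\<And>i. i < c \<Longrightarrow> f i < m"
  shows "\<exists>x<m ^ c. \<forall>i<c. digit m x i = f i"
  using assms
proof (induction c arbitrary: f)
  case (Suc c)
  then have "f (Suc i) < m" if "i < c" for i
    using that by simp
  then obtain x where x: "x < m ^ c" "\<forall>i<c. digit m x i = f (Suc i)"
    using Suc.IH[of "\<lambda>i. f (Suc i)"] by blast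
  have f0: "f 0 < m"
    using Suc.prems by simp
  have "digit m (x * m + f 0) i = f i" if "i < Suc c" for i
    using that x(2) f0 by (cases i) (auto simp: digit_Suc)
  moreover have "x * m + f 0 < m ^ Suc c"
  proof -
    have "x * m + f 0 < Suc x * m"
      using f0 by simp
    also have "\<dots> \<le> m ^ c * m"
      using x(1) by (intro mult_le_mono1) simp
    finally show ?thesis
      by (simp add: mult.commute)
  qed
  ultimately show ?case
    by blast
qed simp


subsection \<open>The graph of codes\<close>

locale tar_instance = split_reconf c k K I E
  for c k :: nat and K I :: "nat set" and E :: "nat rel" +
  fixes n :: nat
  assumes vertices: "K \<union> I = {..<n}"
begin

text \<open>A number below \<open>(n + 1) ^ c\<close> codes the set of those of its digits that lie in \<open>K\<close>; all other
  digits, in particular \<open>n\<close>, are blanks.\<close>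

abbreviation dg :: "nat \<Rightarrow> nat \<Rightarrow> nat" where
  "dg x i \<equiv> digit (Suc n) x i"

abbreviation upd :: "nat \<Rightarrow> nat \<Rightarrow> nat \<Rightarrow> nat" where
  "upd x i w \<equiv> set_digit (Suc n) x i w"

abbreviation N :: nat where
  "N \<equiv> Suc n ^ c"

definition part :: "nat \<Rightarrow> nat set" where
  "part x = dg x ` {..<c} \<inter> K"

text \<open>For \<open>v\<close> in \<open>I\<close> a single condition covers both cases of
  \<open>fill\<close>: a blank digit has no edge to \<open>v\<close>, and a code without blanks and
  repetitions holds exactly \<open>c\<close> clique vertices.\<close>

definition counted :: "nat \<Rightarrow> nat \<Rightarrow> bool" where
  "counted x v \<longleftrightarrow> (if v \<in> K then \<exists>i<c. dg x i = v else \<exists>i<c. (dg x i, v) \<notin> E)"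

text \<open>A lower bound for \<open>card (fill (part x))\<close>, exact if no clique vertex occurs twice.\<close>

definition weight :: "nat \<Rightarrow> nat" where
  "weight x = (\<Sum>v<n. of_bool (counted x v))"

text \<open>Either a digit becomes the blank \<open>n\<close>, or a blank \<open>n\<close> is
  overwritten by \<open>w\<close>. In both cases \<open>k\<close> is compared with the weight of the
  code whose part is the larger one.\<close>

definition adj :: "nat \<Rightarrow> nat \<Rightarrow> bool" where
  "adj x y \<longleftrightarrow> (\<exists>i<c. \<exists>w\<le>n. y = upd x i w \<and> (w = n \<and> k < weight x \<or> dg x i = n \<and> k < weight y))"

text \<open>On these codes the weight is exact, and every TAR move can be followed by codes of this
  kind.\<close>

definition regular :: "nat \<Rightarrow> bool" where
  "regular x \<longleftrightarrow> (\<forall>i<c. dg x i \<in> insert n K) \<and>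
     (\<forall>i<c. \<forall>j<c. dg x i = dg x j \<longrightarrow> dg x i \<noteq> n \<longrightarrow> i = j)"

section \<open>Weights of codes compared with sizes of filled sets\<close>

lemma K_less: "v \<in> K \<Longrightarrow> v < n" and I_less: "v \<in> I \<Longrightarrow> v < n"
  and less_n_cases: "v < n \<Longrightarrow> v \<in> K \<or> v \<in> I"
  using vertices by auto

lemma blank_not_edge: "(n, v) \<notin> E"
  using E_subset vertices by auto

lemma weight_eq_card: "weight x = card {v. v < n \<and> counted x v}"
  by (simp add: weight_def sum_of_bool_eq Int_def)

lemma part_subset: "part x \<subseteq> K"
  by (simp add: part_def)

lemma card_part_le: "card (part x) \<le> c"
proof -
  have "card (part x) \<le> card (dg x ` {..<c})"
    by (auto simp: part_def intro: card_mono)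
  then show ?thesis
    using card_image_le[of "{..<c}" "dg x"] by simp
qed

text \<open>If \<open>part x\<close> has \<open>c\<close> elements, every digit of \<open>x\<close>
  is a clique vertex, so the digit that witnesses a missing edge lies in \<open>part x\<close>. With
  fewer elements \<open>fill\<close> contains all of \<open>I\<close>.\<close>

lemma counted_subset_fill: "{v. v < n \<and> counted x v} \<subseteq> fill (part x)"
proof safe
  fix v assume v: "v < n" "counted x v"
  show "v \<in> fill (part x)"
  proof (cases "v \<in> K")
    case False
    then obtain i where i: "i < c" "(dg x i, v) \<notin> E"
      using v by (auto simp: counted_def)
    have "dg x i \<in> part x" if "card (part x) = c"
    proof -
      have "card (dg x ` {..<c}) \<le> c"
        using card_image_le[of "{..<c}" "dg x"] by simp
      then have "part x = dg x ` {..<c}"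
        using that by (intro card_seteq) (auto simp: part_def)
      then show ?thesis
        using i by auto
    qed
    then show ?thesis
      using False i v less_n_cases by (auto simp: fill_def)
  qed (use v in \<open>auto simp: fill_def part_def counted_def\<close>)
qed

lemma weight_le: "weight x \<le> card (fill (part x))"
  unfolding weight_eq_card using counted_subset_fill finite_fill[OF part_subset]
  by (intro card_mono)

text \<open>A blank makes every vertex of \<open>I\<close> counted. Without blanks the digits are
  \<open>c\<close> distinct clique vertices, so \<open>fill\<close> itself provides a
  non-neighbour.\<close>

lemma regular_fill_subset_counted:
  assumes "regular x"
  shows "fill (part x) \<subseteq> {v. v < n \<and> counted x v}"
proof safe
  fix v assume v: "v \<in> fill (part x)"
  then show "v < n"
    using K_less I_less by (auto simp: fill_def part_def)
  show "counted x v"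
  proof (cases "v \<in> part x")
    case True
    then show ?thesis
      by (auto simp: part_def counted_def)
  next
    case False
    with v have vI: "v \<in> I" "v \<notin> K" and *: "card (part x) = c \<longrightarrow> (\<exists>u\<in>part x. (u, v) \<notin> E)"
      using disjoint by (auto simp: fill_def)
    have "\<exists>i<c. (dg x i, v) \<notin> E"
    proof (cases "\<exists>i<c. dg x i = n")
      case True
      then show ?thesis
        using blank_not_edge by metis
    next
      case no_blank: False
      then have "inj_on (dg x) {..<c}" "part x = dg x ` {..<c}"
        using assms by (auto simp: regular_def inj_on_def part_def)
      then show ?thesis
        using * by (auto simp: card_image)
    qed
    then show ?thesis
      using vI by (simp add: counted_def)
  qed
qed

lemma regular_weight: "regular x \<Longrightarrow> card (fill (part x)) \<le> weight x"
  unfolding weight_eq_card using regular_fill_subset_counted by (intro card_mono) auto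

section \<open>Edges between codes and moves between sets\<close>

lemma digit_upd: "w \<le> n \<Longrightarrow> dg (upd x i w) j = (if j = i then w else dg x j)"
  by (simp add: digit_set_digit)

lemma upd_less: "x < N \<Longrightarrow> i < c \<Longrightarrow> w \<le> n \<Longrightarrow> upd x i w < N"
  by (rule set_digit_less) auto

text \<open>Soundness for all codes, regular or not: a weight above \<open>k\<close> forces the
  filled set above \<open>k\<close>, and \<open>connected_fill_remove\<close> applies to the larger
  part.\<close>

lemma adj_connected:
  assumes "adj x y" "k \<le> card (fill (part x))"
  shows "k \<le> card (fill (part y)) \<and> move\<^sup>*\<^sup>* (fill (part x)) (fill (part y))"
proof -
  obtain i w where iw: "i < c" "w \<le> n" "y = upd x i w"
      "w = n \<and> k < weight x \<or> dg x i = n \<and> k < weight y"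
    using assms(1) by (auto simp: adj_def)
  have dy: "dg y j = (if j = i then w else dg x j)" for j
    using iw digit_upd by simp
  have nK: "n \<notin> K"
    using K_less by blast
  from iw(4) show ?thesis
  proof
    assume *: "w = n \<and> k < weight x"
    \<comment> \<open>Inclusions are all that holds: the overwritten digit may occur again
      elsewhere, or may be blank.\<close>
    then have "part y \<subseteq> part x" "part x \<subseteq> insert (dg x i) (part y)"
      using nK unfolding part_def by (auto simp: dy image_iff split: if_splits)
    then show ?thesis
      using * weight_le[of x] part_subset card_part_le by (intro connected_fill_remove) auto
  next
    assume *: "dg x i = n \<and> k < weight y"
    then have "part x \<subseteq> part y" "part y \<subseteq> insert w (part x)"
      using nK unfolding part_def by (auto simp: dy image_iff split: if_splits)
    then have "move\<^sup>*\<^sup>* (fill (part y)) (fill (part x))"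
      using * weight_le[of y] part_subset card_part_le connected_fill_remove by (metis less_le_trans)
    then show ?thesis
      using * weight_le[of y] connected_sym by auto
  qed
qed

lemma reachable_code_connected:
  assumes "adj\<^sup>*\<^sup>* x y" "k \<le> card (fill (part x))"
  shows "k \<le> card (fill (part y)) \<and> move\<^sup>*\<^sup>* (fill (part x)) (fill (part y))"
  using assms by (induction rule: rtranclp_induct) (auto dest: adj_connected)

text \<open>The at most \<open>c\<close> clique vertices of \<open>S\<close> occupy the first
  digits, and the remaining digits are \<open>n\<close>.\<close>

lemma ex_regular_code:
  assumes "colorable S"
  shows "\<exists>x<N. regular x \<and> part x = S \<inter> K"
proof -
  let ?X = "S \<inter> K"
  obtain g where g: "bij_betw g {0..<card ?X} ?X"
    using ex_bij_betw_nat_finite[of ?X] finite_K by blast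
  define f where "f i = (if i < card ?X then g i else n)" for i
  have gX: "g i \<in> ?X" if "i < card ?X" for i
    using g that by (auto simp: bij_betw_def)
  have inj: "i = j" if "i < card ?X" "j < card ?X" "g i = g j" for i j
    using g that by (auto simp: bij_betw_def inj_on_def)
  have nK: "n \<notin> K"
    using K_less by blast
  have "f i < Suc n" for i
    using gX[of i] K_less[of "g i"] by (auto simp: f_def)
  then obtain x where x: "x < N" "\<forall>i<c. dg x i = f i"
    using ex_digits[of c f "Suc n"] by blast
  have "regular x"
    using x gX inj nK by (auto simp: regular_def f_def)
  moreover have "part x = ?X"
  proof
    show "part x \<subseteq> ?X"
      using x gX nK by (auto simp: part_def f_def split: if_splits)
    show "?X \<subseteq> part x"
    proof
      fix v assume v: "v \<in> ?X"
      then have "v \<in> g ` {0..<card ?X}"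
        using g by (simp add: bij_betw_def)
      then obtain i where i: "i < card ?X" "g i = v"
        by auto
      then have "i < c"
        using card_clique_part_le[OF assms] by simp
      then show "v \<in> part x"
        using x v i by (auto simp: part_def f_def image_iff intro!: bexI[of _ i])
    qed
  qed
  ultimately show ?thesis
    using x by blast
qed

text \<open>Completeness: a change in \<open>I\<close> leaves the code as it is, an inserted clique
  vertex takes the place of a blank, and a removed one becomes a blank.\<close>

lemma code_move:
  assumes "move S T" "regular x" "part x = S \<inter> K"
  shows "\<exists>y. adj\<^sup>*\<^sup>* x y \<and> regular y \<and> part y = T \<inter> K"
proof -
  have col: "colorable S" "colorable T" and k: "k \<le> card S" "k \<le> card T"
    and "card (sym_diff S T) = 1"
    using assms(1) by (auto simp: move_def tar_step_def)
  then obtain v where v: "sym_diff S T = {v}"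
    by (auto simp: card_1_singleton_iff)
  have fin: "finite S" "finite T"
    using col finite_colorable by auto
  have nK: "n \<notin> K"
    using K_less by blast
  have iff: "x \<in> S \<longleftrightarrow> x \<in> T" if "x \<noteq> v" for x
  proof -
    have "x \<notin> sym_diff S T"
      using that unfolding v by simp
    then show ?thesis
      by blast
  qed
  have "v \<in> sym_diff S T"
    unfolding v by simp
  then have "v \<in> S \<longleftrightarrow> v \<notin> T"
    by blast
  then have "x \<in> T \<longleftrightarrow> (if v \<in> S then x \<in> S - {v} else x \<in> insert v S)" for x
    using iff[of x] by (cases "x = v") auto
  then have "v \<in> S \<Longrightarrow> T = S - {v}" "v \<notin> S \<Longrightarrow> T = insert v S"
    by (simp_all add: set_eq_iff)
  then consider "v \<notin> K" | "v \<in> K" "v \<notin> S" "T = insert v S" | "v \<in> K" "v \<in> S" "T = S - {v}"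
    by blast
  then show ?thesis
  proof cases
    case 1
    then have "x \<in> S \<inter> K \<longleftrightarrow> x \<in> T \<inter> K" for x
      using iff[of x] by (cases "x = v") auto
    then have "S \<inter> K = T \<inter> K"
      by blast
    then show ?thesis
      using assms by auto
  next
    case 2
    \<comment> \<open>Without a blank, \<open>S\<close> would already hold \<open>c\<close> clique
      vertices and \<open>T\<close> would hold \<open>c + 1\<close>.\<close>
    have "\<exists>i<c. dg x i = n"
    proof (rule ccontr)
      assume "\<not> ?thesis"
      then have "inj_on (dg x) {..<c}" "part x = dg x ` {..<c}"
        using assms(2) by (auto simp: regular_def inj_on_def part_def)
      then have "card (S \<inter> K) = c"
        using assms(3) by (metis card_image card_lessThan)
      moreover have "card (insert v (S \<inter> K)) \<le> c"
        using card_clique_part_le[OF col(2)] 2 by simp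
      ultimately show False
        using 2 finite_K by simp
    qed
    then obtain i where i: "i < c" "dg x i = n"
      by blast
    have vn: "v < n"
      using 2 K_less by blast
    let ?y = "upd x i v"
    have dy: "dg ?y j = (if j = i then v else dg x j)" for j
      using vn by (simp add: digit_upd)
    have ne: "dg x j \<noteq> v" if "j < c" for j
      using that 2 assms(3) by (auto simp: part_def)
    have reg: "regular ?y"
      using assms(2) i ne 2 by (auto simp: regular_def dy split: if_splits)
    have part: "part ?y = T \<inter> K"
    proof -
      have "part ?y = insert v (part x)"
        using i 2 nK by (auto simp: part_def dy image_iff split: if_splits)
      then show ?thesis
        using 2 assms(3) by auto
    qed
    \<comment> \<open>The smaller set \<open>S\<close> has at least \<open>k\<close> elements.
      Exactness of the weight for the regular code then turns this into the edge condition.\<close>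
    have "k < card T"
      using 2 k fin by simp
    also have "\<dots> \<le> weight ?y"
      using regular_weight[OF reg] colorable_subset_fill[OF col(2)] finite_fill[OF part_subset, of ?y] part
      by (metis card_mono order_trans)
    finally have "adj x ?y"
      unfolding adj_def using i vn by (intro exI[of _ i] conjI exI[of _ v]) auto
    then show ?thesis
      using reg part by blast
  next
    case 3
    then have "v \<in> part x"
      using assms(3) by blast
    then obtain i where i: "i < c" "dg x i = v"
      by (auto simp: part_def)
    let ?y = "upd x i n"
    have dy: "dg ?y j = (if j = i then n else dg x j)" for j
      by (simp add: digit_upd)
    have vn: "v \<noteq> n"
      using 3 nK by blast
    have reg: "regular ?y"
      using assms(2) by (auto simp: regular_def dy split: if_splits)
    have ne: "dg x j \<noteq> v" if "j < c" "j \<noteq> i" for j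
      using that assms(2) i vn by (auto simp: regular_def)
    have part: "part ?y = T \<inter> K"
    proof -
      have "part ?y = part x - {v}"
        using i ne nK by (auto simp: part_def dy image_iff split: if_splits)
      then show ?thesis
        using 3 assms(3) by auto
    qed
    have "card S = Suc (card T)"
      using 3 fin card_Suc_Diff1[of S v] by simp
    then have "k < card S"
      using k by simp
    also have "\<dots> \<le> weight x"
      using regular_weight[OF assms(2)] colorable_subset_fill[OF col(1)]
        finite_fill[OF part_subset, of x] assms(3)
      by (metis card_mono order_trans)
    finally have "adj x ?y"
      unfolding adj_def using i by (intro exI[of _ i] conjI exI[of _ n]) auto
    then show ?thesis
      using reg part by blast
  qed
qed

text \<open>Forwards, a regular code of \<open>S\<close> follows the moves. Backwards, any codes
  serve: the path leads from \<open>S\<close> up to its filled set, along the codes, and down to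
  \<open>S'\<close>.\<close>

lemma connected_iff_codes:
  assumes "colorable S" "k \<le> card S" "colorable S'" "k \<le> card S'"
  shows "move\<^sup>*\<^sup>* S S' \<longleftrightarrow>
    (\<exists>x y. x < N \<and> part x = S \<inter> K \<and> adj\<^sup>*\<^sup>* x y \<and> part y = S' \<inter> K)"
proof
  assume *: "move\<^sup>*\<^sup>* S S'"
  obtain x where x: "x < N" "regular x" "part x = S \<inter> K"
    using ex_regular_code[OF assms(1)] by blast
  from * have "\<exists>y. adj\<^sup>*\<^sup>* x y \<and> regular y \<and> part y = S' \<inter> K"
  proof (induction rule: rtranclp_induct)
    case (step T U)
    then show ?case
      using code_move by (meson rtranclp_trans)
  qed (use x in blast)
  then show "\<exists>x y. x < N \<and> part x = S \<inter> K \<and> adj\<^sup>*\<^sup>* x y \<and> part y = S' \<inter> K"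
    using x by blast
next
  assume "\<exists>x y. x < N \<and> part x = S \<inter> K \<and> adj\<^sup>*\<^sup>* x y \<and> part y = S' \<inter> K"
  then obtain x y where xy: "part x = S \<inter> K" "adj\<^sup>*\<^sup>* x y" "part y = S' \<inter> K"
    by blast
  have "card S \<le> card (fill (part x))"
    using xy colorable_subset_fill[OF assms(1)] finite_fill[OF part_subset, of x]
    by (intro card_mono) auto
  then have "move\<^sup>*\<^sup>* (fill (S \<inter> K)) (fill (S' \<inter> K))"
    using reachable_code_connected[OF xy(2)] assms(2) xy by auto
  moreover have "move\<^sup>*\<^sup>* S (fill (S \<inter> K))" "move\<^sup>*\<^sup>* (fill (S' \<inter> K)) S'"
    using assms connected_fill connected_sym by auto
  ultimately show "move\<^sup>*\<^sup>* S S'"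
    by (meson rtranclp_trans)
qed

end


subsection \<open>The program\<close>

primrec block :: "com list \<Rightarrow> com" where
  "block [] = Skip"
| "block (p # ps) = Seq p (block ps)"

abbreviation (input) "rAns \<equiv> (0 :: nat)"
abbreviation (input) "rn \<equiv> (2 :: nat)"
abbreviation (input) "rk \<equiv> (3 :: nat)"
abbreviation (input) "rM \<equiv> (4 :: nat)"
abbreviation (input) "rN \<equiv> (5 :: nat)"
abbreviation (input) "rP \<equiv> (6 :: nat)"
abbreviation (input) "rX \<equiv> (7 :: nat)"
abbreviation (input) "rTail \<equiv> (8 :: nat)"
abbreviation (input) "rHead \<equiv> (9 :: nat)"
abbreviation (input) "rSize \<equiv> (10 :: nat)"
abbreviation (input) "rV \<equiv> (11 :: nat)"
abbreviation (input) "rS \<equiv> (12 :: nat)"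
abbreviation (input) "rT \<equiv> (13 :: nat)"
abbreviation (input) "rB \<equiv> (14 :: nat)"
abbreviation (input) "rW \<equiv> (15 :: nat)"
abbreviation (input) "rY \<equiv> (16 :: nat)"

text \<open>The exponent is fixed when the program is written, so unrolling gives an expression
  whose work does not depend on the input.\<close>

primrec power_expr :: "nat \<Rightarrow> expr" where
  "power_expr 0 = Const 1"
| "power_expr (Suc i) = Op Mul (Reg rM) (power_expr i)"

definition digit_expr :: "nat \<Rightarrow> expr" where
  "digit_expr i = Op Mod (Op Div (Reg rX) (power_expr i)) (Reg rM)"

primrec count_expr :: "(nat \<Rightarrow> expr) \<Rightarrow> nat \<Rightarrow> expr" where
  "count_expr f 0 = Const 0"
| "count_expr f (Suc j) = Op Add (count_expr f j) (f j)"

definition any_expr :: "(nat \<Rightarrow> expr) \<Rightarrow> nat \<Rightarrow> expr" where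
  "any_expr f j = Op Less (Const 0) (count_expr f j)"

text \<open>Behind the input, each code \<open>x\<close> owns four cells: is its weight above \<open>k\<close>, does it code the
  target, is it visited, and the \<open>x\<close>-th entry of the queue.\<close>

definition cell :: "nat \<Rightarrow> nat \<Rightarrow> nat \<Rightarrow> nat" where
  "cell P x a = P + (4 * x + a)"

definition cell_expr :: "expr \<Rightarrow> nat \<Rightarrow> expr" where
  "cell_expr e a = Op Add (Reg rP) (Op Add (Op Mul (Const 4) e) (Const a))"

text \<open>The table starts \<open>n\<close> cells behind the end of the input. These zero cells
  act as row \<open>n\<close> of the adjacency matrix and make the blank \<open>n\<close> an
  isolated vertex.\<close>

definition load_input :: "nat \<Rightarrow> com" where
  "load_input c = block
    [Assign rn (Load (Const 0)),
     Assign rk (Load (Const 1)),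
     Assign rM (Op Add (Reg rn) (Const 1)),
     Assign rN (power_expr c),
     Assign rP (Op Add (Op Add (Const 2) (Op Mul (Const 4) (Reg rn))) (Op Mul (Reg rn) (Reg rn)))]"

definition code_begin :: com where
  "code_begin = block
    [Assign rSize (Const 0), Assign rS (Const 1), Assign rT (Const 1), Assign rV (Const 0)]"

text \<open>\<open>rSize\<close> accumulates the weight. \<open>rS\<close> and \<open>rT\<close> are
  conjunctions, written as products, stating that the coded set agrees so far with \<open>S\<close>
  and \<open>S'\<close> on \<open>K\<close>.\<close>

definition code_vertex :: "nat \<Rightarrow> com" where
  "code_vertex c = block
    [Cond (Load (Op Add (Const 2) (Reg rV)))
      (block
        [Assign rB (any_expr (\<lambda>i. Op Equal (digit_expr i) (Reg rV)) c),
         Assign rSize (Op Add (Reg rSize) (Reg rB)),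
         Assign rS (Op Mul (Reg rS) (Op Equal (Reg rB)
           (Load (Op Add (Op Add (Const 2) (Reg rn)) (Reg rV))))),
         Assign rT (Op Mul (Reg rT) (Op Equal (Reg rB)
           (Load (Op Add (Op Add (Const 2) (Op Mul (Const 2) (Reg rn))) (Reg rV)))))])
      (Assign rSize (Op Add (Reg rSize) (any_expr (\<lambda>i. Op Equal (Const 0)
        (Load (Op Add (Op Add (Op Add (Const 2) (Op Mul (Const 3) (Reg rn)))
          (Op Mul (digit_expr i) (Reg rn))) (Reg rV)))) c))),
     Assign rV (Op Add (Reg rV) (Const 1))]"

text \<open>Codes of the clique part of \<open>S\<close> enter the queue at once, so the search
  starts from all of them.\<close>

definition code_end :: com where
  "code_end = block
    [Store (cell_expr (Reg rX) 0) (Op Less (Reg rk) (Reg rSize)),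
     Store (cell_expr (Reg rX) 1) (Reg rT),
     Store (cell_expr (Reg rX) 2) (Reg rS),
     Cond (Reg rS)
       (block [Store (cell_expr (Reg rTail) 3) (Reg rX), Assign rTail (Op Add (Reg rTail) (Const 1))])
       Skip,
     Assign rX (Op Add (Reg rX) (Const 1))]"

definition tabulate :: "nat \<Rightarrow> com" where
  "tabulate c = While (Op Less (Reg rX) (Reg rN))
    (Seq code_begin (Seq (While (Op Less (Reg rV) (Reg rn)) (code_vertex c)) code_end))"

definition visit_begin :: com where
  "visit_begin = block
    [Assign rX (Load (cell_expr (Reg rHead) 3)),
     Assign rHead (Op Add (Reg rHead) (Const 1)),
     Cond (Load (cell_expr (Reg rX) 1)) (Assign rAns (Const 1)) Skip,
     Assign rW (Const 0)]"

text \<open>Products and sums of truth values act as conjunctions and disjunctions; a sum of 2 still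
  counts as true.\<close>

definition push :: "nat \<Rightarrow> com" where
  "push i = block
    [Assign rY (Op Add (Op Sub (Reg rX) (Op Mul (digit_expr i) (power_expr i)))
       (Op Mul (Reg rW) (power_expr i))),
     Cond (Op Mul (Op Equal (Load (cell_expr (Reg rY) 2)) (Const 0))
        (Op Add (Op Mul (Op Equal (Reg rW) (Reg rn)) (Load (cell_expr (Reg rX) 0)))
          (Op Mul (Op Equal (digit_expr i) (Reg rn)) (Load (cell_expr (Reg rY) 0)))))
       (block
         [Store (cell_expr (Reg rTail) 3) (Reg rY),
          Store (cell_expr (Reg rY) 2) (Const 1),
          Assign rTail (Op Add (Reg rTail) (Const 1))])
       Skip]"

text \<open>Unrolled over the \<open>c\<close> positions; only the new digit value runs through a
  loop, so expanding one code takes linear time.\<close>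

primrec push_all :: "nat \<Rightarrow> com" where
  "push_all 0 = Skip"
| "push_all (Suc i) = Seq (push_all i) (push i)"

definition push_row :: "nat \<Rightarrow> com" where
  "push_row c = Seq (push_all c) (Assign rW (Op Add (Reg rW) (Const 1)))"

definition search :: "nat \<Rightarrow> com" where
  "search c = While (Op Less (Reg rHead) (Reg rTail))
    (Seq visit_begin (While (Op Less (Reg rW) (Reg rM)) (push_row c)))"

definition program :: "nat \<Rightarrow> com" where
  "program c = Seq (load_input c) (Seq (tabulate c) (search c))"

text \<open>Each 4 is the price of one loop test: three units for comparing two registers and one
  for the branch.\<close>

definition time :: "nat \<Rightarrow> nat \<Rightarrow> nat" where
  "time c n = cost (load_input c) +
     (Suc n ^ c * (4 + (cost code_begin + (n * (4 + cost (code_vertex c)) + 4 + cost code_end))) + 4 +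
     (Suc n ^ c * (4 + (cost visit_begin + (Suc n * (4 + cost (push_row c)) + 4))) + 4))"

section \<open>Values and constants of the expressions\<close>

lemma val_power_expr [simp]: "val (power_expr i) \<sigma> = fst \<sigma> rM ^ i"
  by (induction i) auto

lemma val_digit_expr [simp]: "val (digit_expr i) \<sigma> = digit (fst \<sigma> rM) (fst \<sigma> rX) i"
  by (simp add: digit_expr_def digit_def)

lemma val_any_expr [simp]: "val (any_expr f j) \<sigma> = of_bool (\<exists>i<j. val (f i) \<sigma> \<noteq> 0)"
proof -
  have "val (count_expr f j) \<sigma> = (\<Sum>i<j. val (f i) \<sigma>)"
    by (induction j) auto
  then show ?thesis
    by (auto simp: any_expr_def)
qed

lemma val_cell_expr [simp]: "val (cell_expr e a) \<sigma> = cell (fst \<sigma> rP) (val e \<sigma>) a"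
  by (simp add: cell_expr_def cell_def)

lemma cell_eq_iff [simp]: "a < 4 \<Longrightarrow> b < 4 \<Longrightarrow> cell P x a = cell P y b \<longleftrightarrow> x = y \<and> a = b"
  unfolding cell_def by presburger

lemma cell_ge: "P \<le> cell P x a"
  by (simp add: cell_def)

lemma loop_free_push_all [simp]: "loop_free (push_all i)"
  by (induction i) (auto simp: push_def)

lemma consts_le_power_expr: "1 \<le> X \<Longrightarrow> consts_le X (power_expr i)"
  by (induction i) auto

lemma consts_le_any_expr: "(\<And>i. consts_le X (f i)) \<Longrightarrow> consts_le X (any_expr f j)"
  unfolding any_expr_def by (induction j) auto

lemma consts_le_program:
  assumes "4 \<le> X"
  shows "prog_consts_le X (program c)"
proof -
  have d: "consts_le X (digit_expr i)" and p: "consts_le X (power_expr i)" for i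
    using assms consts_le_power_expr by (auto simp: digit_expr_def)
  have "prog_consts_le X (push_all i)" for i
    using assms by (induction i) (auto simp: push_def d p cell_expr_def)
  moreover have "prog_consts_le X (code_vertex c)"
    using assms by (auto simp: code_vertex_def d intro!: consts_le_any_expr)
  ultimately show ?thesis
    using assms
    by (auto simp: program_def load_input_def tabulate_def code_begin_def code_end_def search_def
        visit_begin_def push_row_def cell_expr_def p)
qed


subsection \<open>Correctness of the program\<close>

locale tar_input = tar_instance c k K I E n
  for c k :: nat and K I :: "nat set" and E :: "nat rel" and n :: nat +
  fixes S S' :: "nat set"
  assumes colorable_S: "colorable S" and k_le_S: "k \<le> card S"
    and colorable_S': "colorable S'" and k_le_S': "k \<le> card S'"
begin

section \<open>Word size and layout of the input\<close>

definition P :: nat where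
  "P = 2 + 4 * n + n * n"

text \<open>Large enough for the table address \<open>P\<close>, quadratic in \<open>n\<close>, and
  for the number \<open>N\<close> of codes. The base \<open>n + 2\<close> keeps it at least 4 even
  for \<open>n = 0\<close>.\<close>

definition X :: nat where
  "X = (n + 2) ^ (c + 2)"

text \<open>The exponent depends on \<open>c\<close> alone, so words have logarithmic
  length.\<close>

definition B :: nat where
  "B = X ^ cost (program c)"

definition input :: "nat \<Rightarrow> nat" where
  "input = snd (initial_state (encode_instance n k K E S S'))"

lemma k_le_n: "k \<le> n"
proof -
  have "card S \<le> card {..<n}"
    using colorable_S vertices by (intro card_mono) (auto simp: colorable_set_def)
  then show ?thesis
    using k_le_S by simp
qed

lemma length_encode: "length (encode_instance n k K E S S') = 2 + 3 * n + n * n"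
  by (simp add: encode_instance_def)

lemma input_0: "input 0 = n" and input_1: "input 1 = k"
  by (simp_all add: input_def initial_state_def encode_instance_def)

lemma input_K: "v < n \<Longrightarrow> input (2 + v) = of_bool (v \<in> K)"
  and input_S: "v < n \<Longrightarrow> input (2 + n + v) = of_bool (v \<in> S)"
  and input_S': "v < n \<Longrightarrow> input (2 + 2 * n + v) = of_bool (v \<in> S')"
  by (auto simp: input_def initial_state_def encode_instance_def nth_append)

text \<open>The case \<open>u = n\<close> reads the zero cells behind the input, in accordance with
  the blank having no edges.\<close>

lemma input_E:
  assumes "u \<le> n" "v < n"
  shows "input (2 + 3 * n + u * n + v) = of_bool ((u, v) \<in> E)"
proof (cases "u = n")
  case True
  then show ?thesis
    using blank_not_edge length_encode by (simp add: input_def initial_state_def)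
next
  case False
  then have "Suc u * n \<le> n * n"
    using assms by (intro mult_le_mono1) simp
  then have lt: "u * n + v < n * n"
    using assms by simp
  have "List.product [0..<n] [0..<n] ! (u * n + v) = (u, v)"
    using assms lt False by (subst product_nth) auto
  then show ?thesis
    using lt length_encode
    by (simp add: input_def initial_state_def encode_instance_def nth_append)
qed

lemma input_le: "input a \<le> X"
proof -
  have "n < X"
  proof -
    have "n < (n + 2) ^ 1"
      by simp
    also have "\<dots> \<le> X"
      unfolding X_def by (intro power_increasing) auto
    finally show ?thesis .
  qed
  moreover have "set (encode_instance n k K E S S') \<subseteq> {n, k, 0, 1}"
    by (auto simp: encode_instance_def of_bool_def)
  then have "a < length (encode_instance n k K E S S') \<Longrightarrow>
      encode_instance n k K E S S' ! a \<in> {n, k, 0, 1}"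
    using nth_mem by blast
  ultimately show ?thesis
    using k_le_n by (auto simp: input_def initial_state_def)
qed

lemma X_bounds: "P \<le> X" "N \<le> X" "n + 2 \<le> X" "4 \<le> X"
proof -
  have "N \<le> (n + 2) ^ c"
    by (intro power_mono) auto
  also have "\<dots> \<le> X"
    unfolding X_def by (intro power_increasing) auto
  finally show "N \<le> X" .
  have "P \<le> (n + 2) ^ 2"
    by (simp add: P_def power2_eq_square)
  also have *: "\<dots> \<le> X"
    unfolding X_def by (intro power_increasing) auto
  finally show "P \<le> X" .
  show "n + 2 \<le> X" "4 \<le> X"
    using * by (auto simp: power2_eq_square)
qed

lemma runs_piece:
  assumes "loop_free p" "prog_consts_le X p" "cost p \<le> cost (program c)" "bounded X \<sigma>"
    "stores_le X p \<sigma>" "Q (sem p \<sigma>)"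
  shows "runs B p \<sigma> (cost p) (\<lambda>\<tau>. bounded X \<tau> \<and> Q \<tau>)"
proof -
  have "X ^ cost p \<le> B"
    unfolding B_def using assms(3) X_bounds by (intro power_increasing) auto
  then show ?thesis
    using assms X_bounds by (intro runs_loop_free[of X]) auto
qed

lemma fits_piece:
  assumes "consts_le X e" "work e \<le> cost (program c)" "bounded X \<sigma>"
  shows "fits B e \<sigma>"
proof -
  have "X ^ work e \<le> B"
    unfolding B_def using assms(2) X_bounds by (intro power_increasing) auto
  then show ?thesis
    using assms X_bounds by (intro fits_if_bounded[of X]) auto
qed

section \<open>Invariants of the tabulation\<close>

definition ready :: "state \<Rightarrow> bool" where
  "ready \<sigma> \<longleftrightarrow> fst \<sigma> rn = n \<and> fst \<sigma> rk = k \<and> fst \<sigma> rM = Suc n \<and> fst \<sigma> rN = N \<and> fst \<sigma> rP = P \<and>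
     (\<forall>a<P. snd \<sigma> a = input a)"

text \<open>\<open>qs\<close> keeps the removed entries too, so it is also the list of visited
  codes. Being distinct and below \<open>m\<close>, it fits into the queue cells of \<open>m\<close>
  codes.\<close>

definition table :: "(nat \<Rightarrow> nat) \<Rightarrow> nat \<Rightarrow> nat list \<Rightarrow> bool" where
  "table h m qs \<longleftrightarrow>
     (\<forall>x<m. h (cell P x 0) = of_bool (k < weight x) \<and>
       h (cell P x 1) = of_bool (part x = S' \<inter> K) \<and> h (cell P x 2) = of_bool (x \<in> set qs)) \<and>
     (\<forall>j<length qs. h (cell P j 3) = qs ! j) \<and> distinct qs \<and> set qs \<subseteq> {..<m}"

lemma table_length_le:
  assumes "table h m qs"
  shows "length qs \<le> m"
proof -
  have "card (set qs) \<le> card {..<m}"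
    using assms by (intro card_mono) (auto simp: table_def)
  then show ?thesis
    using assms by (simp add: table_def distinct_card)
qed

text \<open>The vertexwise form of the comparison, as accumulated in \<open>rS\<close> and
  \<open>rT\<close> during the scan.\<close>

lemma part_eq_iff: "part x = T \<inter> K \<longleftrightarrow> (\<forall>u<n. u \<in> K \<longrightarrow> (u \<in> T \<longleftrightarrow> (\<exists>i<c. dg x i = u)))"
proof -
  have "u \<in> dg x ` {..<c} \<longleftrightarrow> (\<exists>i<c. dg x i = u)" for u
    by auto
  then show ?thesis
    unfolding part_def using K_less by blast
qed

lemma ready_input:
  assumes "ready \<sigma>" "v < n"
  shows "snd \<sigma> (2 + v) = of_bool (v \<in> K)" "snd \<sigma> (2 + n + v) = of_bool (v \<in> S)"
    "snd \<sigma> (2 + 2 * n + v) = of_bool (v \<in> S')"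
    "u \<le> n \<Longrightarrow> snd \<sigma> (2 + 3 * n + u * n + v) = of_bool ((u, v) \<in> E)"
proof -
  have *: "a < P \<Longrightarrow> snd \<sigma> a = input a" for a
    using assms(1) by (simp add: ready_def)
  show "snd \<sigma> (2 + v) = of_bool (v \<in> K)" "snd \<sigma> (2 + n + v) = of_bool (v \<in> S)"
    "snd \<sigma> (2 + 2 * n + v) = of_bool (v \<in> S')"
    using assms(2) by (subst *; simp add: P_def input_K[simplified] input_S[simplified] input_S'[simplified])+
  assume u: "u \<le> n"
  then have "u * n \<le> n * n"
    by (rule mult_le_mono1)
  then have "u * n + v < n * n + n"
    using assms(2) by (rule add_le_less_mono)
  then have "2 + 3 * n + u * n + v < P"
    using assms(2) by (simp add: P_def)
  then show "snd \<sigma> (2 + 3 * n + u * n + v) = of_bool ((u, v) \<in> E)"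
    using assms(2) u by (simp only: * input_E)
qed

definition tabulated :: "nat \<Rightarrow> nat list \<Rightarrow> state \<Rightarrow> bool" where
  "tabulated x qs \<sigma> \<longleftrightarrow> ready \<sigma> \<and> table (snd \<sigma>) x qs \<and> set qs = {y. y < x \<and> part y = S \<inter> K} \<and>
     fst \<sigma> rX = x \<and> x \<le> N \<and> fst \<sigma> rTail = length qs \<and> fst \<sigma> rHead = 0 \<and> fst \<sigma> rAns = 0"

definition agrees :: "nat set \<Rightarrow> nat \<Rightarrow> nat \<Rightarrow> bool" where
  "agrees T x v \<longleftrightarrow> (\<forall>u<v. u \<in> K \<longrightarrow> (u \<in> T \<longleftrightarrow> (\<exists>i<c. dg x i = u)))"

definition scanned :: "nat \<Rightarrow> nat list \<Rightarrow> nat \<Rightarrow> state \<Rightarrow> bool" where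
  "scanned x qs v \<sigma> \<longleftrightarrow> tabulated x qs \<sigma> \<and> fst \<sigma> rV = v \<and> v \<le> n \<and>
     fst \<sigma> rSize = (\<Sum>u<v. of_bool (counted x u)) \<and>
     fst \<sigma> rS = of_bool (agrees S x v) \<and> fst \<sigma> rT = of_bool (agrees S' x v)"

lemma agrees_Suc: "agrees T x (Suc v) \<longleftrightarrow>
    agrees T x v \<and> (v \<in> K \<longrightarrow> (v \<in> T \<longleftrightarrow> (\<exists>i<c. dg x i = v)))"
  by (auto simp: agrees_def less_Suc_eq)

lemma scanned_size_le: "(\<Sum>u<v. of_bool (counted x u)) \<le> v"
  by (simp add: sum_of_bool_eq) (metis card_lessThan card_mono finite_lessThan inf_le1)

section \<open>Correctness of the tabulation\<close>

lemma load_input_correct: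
  "runs B (load_input c) (initial_state (encode_instance n k K E S S')) (cost (load_input c))
    (\<lambda>\<sigma>. bounded X \<sigma> \<and> tabulated 0 [] \<sigma>)"
proof (rule runs_piece)
  show "bounded X (initial_state (encode_instance n k K E S S'))"
    using input_le by (simp add: bounded_def input_def) (simp add: initial_state_def)
  have val: "snd (initial_state (encode_instance n k K E S S')) = input"
    "fst (initial_state (encode_instance n k K E S S')) = (\<lambda>_. 0)"
    by (simp_all add: input_def initial_state_def)
  show "stores_le X (load_input c) (initial_state (encode_instance n k K E S S'))"
    using X_bounds k_le_n by (simp add: load_input_def val input_0 input_1[simplified] P_def)
  show "tabulated 0 [] (sem (load_input c) (initial_state (encode_instance n k K E S S')))"
    by (simp add: load_input_def val input_0 input_1[simplified] tabulated_def ready_def table_def P_def)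
  show "prog_consts_le X (load_input c)"
    using consts_le_program[OF X_bounds(4), of c] by (simp add: program_def)
qed (simp_all add: load_input_def program_def)

lemma code_begin_correct:
  assumes "bounded X \<sigma>" "tabulated x qs \<sigma>"
  shows "runs B code_begin \<sigma> (cost code_begin) (\<lambda>\<tau>. bounded X \<tau> \<and> scanned x qs 0 \<tau>)"
proof (rule runs_piece)
  show "stores_le X code_begin \<sigma>"
    using X_bounds by (simp add: code_begin_def)
  show "scanned x qs 0 (sem code_begin \<sigma>)"
    using assms by (simp add: code_begin_def scanned_def tabulated_def ready_def agrees_def)
  show "prog_consts_le X code_begin"
    using X_bounds by (simp add: code_begin_def)
qed (use assms in \<open>simp_all add: program_def tabulate_def code_begin_def\<close>)

lemma code_vertex_correct:
  assumes "bounded X \<sigma>" "scanned x qs v \<sigma>" "v < n"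
  shows "runs B (code_vertex c) \<sigma> (cost (code_vertex c)) (\<lambda>\<tau>. bounded X \<tau> \<and> scanned x qs (Suc v) \<tau>)"
proof (rule runs_piece)
  have ready: "ready \<sigma>"
    using assms by (simp add: scanned_def tabulated_def)
  note inp = ready_input[OF this assms(3), unfolded add_2_eq_Suc add_Suc]
  have regs: "fst \<sigma> rn = n" "fst \<sigma> rM = Suc n" "fst \<sigma> rX = x" "fst \<sigma> rV = v"
      "fst \<sigma> rSize = (\<Sum>u<v. of_bool (counted x u))"
      "fst \<sigma> rS = of_bool (agrees S x v)" "fst \<sigma> rT = of_bool (agrees S' x v)"
    using assms by (auto simp: scanned_def tabulated_def ready_def)
  have dg_le: "dg x i \<le> n" for i
    using digit_less[of "Suc n" x i] by simp
  note E = inp(4)[OF dg_le]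
  have size: "(\<Sum>u<v. of_bool (counted x u)) \<le> v" "v < X"
    using scanned_size_le X_bounds assms(3) by auto
  show "stores_le X (code_vertex c) \<sigma>"
    using size X_bounds by (simp add: code_vertex_def regs inp E)
  show "scanned x qs (Suc v) (sem (code_vertex c) \<sigma>)"
  proof (cases "v \<in> K")
    case True
    then have "counted x v \<longleftrightarrow> (\<exists>i<c. dg x i = v)"
      by (simp add: counted_def)
    with True show ?thesis
      using assms
      by (simp add: code_vertex_def regs inp scanned_def tabulated_def ready_def agrees_Suc) blast
  next
    case False
    then have "counted x v \<longleftrightarrow> (\<exists>i<c. (dg x i, v) \<notin> E)"
      by (simp add: counted_def)
    with False show ?thesis
      using assms by (simp add: code_vertex_def regs inp E scanned_def tabulated_def ready_def agrees_Suc)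
  qed
  show "prog_consts_le X (code_vertex c)"
    using consts_le_program[OF X_bounds(4), of c] by (simp add: program_def tabulate_def)
qed (use assms in \<open>simp_all add: program_def tabulate_def code_vertex_def\<close>)

lemma scan_correct:
  assumes "bounded X \<sigma>" "scanned x qs 0 \<sigma>"
  shows "runs B (While (Op Less (Reg rV) (Reg rn)) (code_vertex c)) \<sigma>
    (n * (4 + cost (code_vertex c)) + 4) (\<lambda>\<tau>. bounded X \<tau> \<and> scanned x qs n \<tau>)"
proof -
  let ?J = "\<lambda>\<sigma>. bounded X \<sigma> \<and> (\<exists>v. scanned x qs v \<sigma>)"
  let ?e = "Op Less (Reg rV) (Reg rn)"
  have "runs B (While ?e (code_vertex c)) \<sigma>
      ((n - fst \<sigma> rV) * (work ?e + 1 + cost (code_vertex c)) + (work ?e + 1))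
      (\<lambda>\<tau>. ?J \<tau> \<and> val ?e \<tau> = 0)"
  proof (rule runs_While)
    fix \<sigma> assume J: "?J \<sigma>"
    show "fits B ?e \<sigma>"
      using J by (intro fits_piece) (auto simp: program_def tabulate_def)
    assume "val ?e \<sigma> \<noteq> 0"
    moreover obtain v where v: "scanned x qs v \<sigma>"
      using J by blast
    ultimately have "v < n"
      by (auto simp: scanned_def tabulated_def ready_def split: if_splits)
    then have "runs B (code_vertex c) \<sigma> (cost (code_vertex c))
        (\<lambda>\<tau>. bounded X \<tau> \<and> scanned x qs (Suc v) \<tau>)"
      using code_vertex_correct J v by blast
    then show "runs B (code_vertex c) \<sigma> (cost (code_vertex c))
        (\<lambda>\<tau>. ?J \<tau> \<and> n - fst \<tau> rV < n - fst \<sigma> rV)"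
    proof (rule runs_mono[OF _ order_refl])
      fix \<tau> assume *: "bounded X \<tau> \<and> scanned x qs (Suc v) \<tau>"
      then have "fst \<tau> rV = Suc v" "fst \<sigma> rV = v"
        using v by (auto simp: scanned_def)
      then show "?J \<tau> \<and> n - fst \<tau> rV < n - fst \<sigma> rV"
        using * \<open>v < n\<close> by auto
    qed
  qed (use assms in blast)
  then show ?thesis
  proof (rule runs_mono)
    show "(n - fst \<sigma> rV) * (work ?e + 1 + cost (code_vertex c)) + (work ?e + 1)
        \<le> n * (4 + cost (code_vertex c)) + 4"
      using assms by (simp add: scanned_def algebra_simps)
    fix \<tau> assume *: "?J \<tau> \<and> val ?e \<tau> = 0"
    then obtain v where v: "scanned x qs v \<tau>"
      by blast
    then have "v = n"
      using * by (auto simp: scanned_def tabulated_def ready_def split: if_splits)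
    with v show "bounded X \<tau> \<and> scanned x qs n \<tau>"
      using * by blast
  qed
qed

lemma cell_neq_input: "a < P \<Longrightarrow> cell P x b \<noteq> a" "a < P \<Longrightarrow> a \<noteq> cell P x b"
  using cell_ge[of P x b] by auto

lemma table_Suc:
  assumes "table h x qs"
  shows "table (h(cell P x 0 := of_bool (k < weight x), cell P x 1 := of_bool (part x = S' \<inter> K),
    cell P x 2 := 0)) (Suc x) qs"
  using assms by (auto simp: table_def less_Suc_eq)

text \<open>Serves both for the initial entries of the queue and for those found by the
  search.\<close>

lemma table_push:
  assumes "table h m qs" "y < m" "y \<notin> set qs"
  shows "table (h(cell P (length qs) 3 := y, cell P y 2 := 1)) m (qs @ [y])"
  using assms by (auto simp: table_def less_Suc_eq nth_append)

lemma code_end_correct: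
  assumes "bounded X \<sigma>" "scanned x qs n \<sigma>" "x < N"
  shows "runs B code_end \<sigma> (cost code_end) (\<lambda>\<tau>. bounded X \<tau> \<and> (\<exists>qs'. tabulated (Suc x) qs' \<tau>))"
proof (rule runs_piece)
  have regs: "fst \<sigma> rP = P" "fst \<sigma> rk = k" "fst \<sigma> rX = x" "fst \<sigma> rTail = length qs"
      "fst \<sigma> rSize = weight x" "fst \<sigma> rS = of_bool (part x = S \<inter> K)"
      "fst \<sigma> rT = of_bool (part x = S' \<inter> K)"
    using assms part_eq_iff
    by (auto simp: scanned_def tabulated_def ready_def weight_def agrees_def)
  have old: "tabulated x qs \<sigma>"
    using assms by (simp add: scanned_def)
  have tab: "table (snd \<sigma>) x qs" and set: "set qs = {y. y < x \<and> part y = S \<inter> K}"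
    using assms by (auto simp: scanned_def tabulated_def)
  have "length qs \<le> x"
    using table_length_le[OF tab] .
  then show "stores_le X code_end \<sigma>"
    using X_bounds assms(3) by (simp add: code_end_def regs)
  note tab' = table_Suc[OF tab]
  show "\<exists>qs'. tabulated (Suc x) qs' (sem code_end \<sigma>)"
  proof (cases "part x = S \<inter> K")
    case True
    \<comment> \<open>The program writes 1 into the visited cell directly; the interposed value 0
      brings the state into the form of \<open>table_Suc\<close> followed by
      \<open>table_push\<close>.\<close>
    have eq: "snd (sem code_end \<sigma>) = (snd \<sigma>)(cell P x 0 := of_bool (k < weight x),
        cell P x 1 := of_bool (part x = S' \<inter> K), cell P x 2 := 0,
        cell P (length qs) 3 := x, cell P x 2 := 1)"
      by (auto simp: code_end_def regs True fun_eq_iff)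
    have "table (snd (sem code_end \<sigma>)) (Suc x) (qs @ [x])"
      unfolding eq by (rule table_push[OF tab']) (auto simp: set)
    moreover have "set (qs @ [x]) = {y. y < Suc x \<and> part y = S \<inter> K}"
      using True by (auto simp: set less_Suc_eq)
    moreover have fst: "fst (sem code_end \<sigma>) = (fst \<sigma>)(rTail := Suc (length qs), rX := Suc x)"
      by (simp add: code_end_def regs True)
    moreover have "ready (sem code_end \<sigma>)"
      using old by (simp add: tabulated_def ready_def eq fst cell_neq_input)
    ultimately have "tabulated (Suc x) (qs @ [x]) (sem code_end \<sigma>)"
      using old assms(3) unfolding tabulated_def by simp
    then show ?thesis ..
  next
    case False
    have eq: "snd (sem code_end \<sigma>) = (snd \<sigma>)(cell P x 0 := of_bool (k < weight x),
        cell P x 1 := of_bool (part x = S' \<inter> K), cell P x 2 := 0)"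
      by (auto simp: code_end_def regs False fun_eq_iff)
    have "table (snd (sem code_end \<sigma>)) (Suc x) qs"
      unfolding eq by (rule tab')
    moreover have "set qs = {y. y < Suc x \<and> part y = S \<inter> K}"
      using False by (auto simp: set less_Suc_eq)
    moreover have fst: "fst (sem code_end \<sigma>) = (fst \<sigma>)(rX := Suc x)"
      by (simp add: code_end_def regs False)
    moreover have "ready (sem code_end \<sigma>)"
      using old by (simp add: tabulated_def ready_def eq fst cell_neq_input)
    ultimately have "tabulated (Suc x) qs (sem code_end \<sigma>)"
      using old assms(3) unfolding tabulated_def by simp
    then show ?thesis ..
  qed
  show "prog_consts_le X code_end"
    using X_bounds by (simp add: code_end_def cell_expr_def)
qed (use assms in \<open>simp_all add: program_def tabulate_def code_end_def\<close>)

lemma tabulate_correct: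
  assumes "bounded X \<sigma>" "tabulated 0 [] \<sigma>"
  shows "runs B (tabulate c) \<sigma>
    (N * (4 + (cost code_begin + (n * (4 + cost (code_vertex c)) + 4 + cost code_end))) + 4)
    (\<lambda>\<tau>. bounded X \<tau> \<and> (\<exists>qs. tabulated N qs \<tau>))"
proof -
  let ?J = "\<lambda>\<sigma>. bounded X \<sigma> \<and> (\<exists>x qs. tabulated x qs \<sigma>)"
  let ?e = "Op Less (Reg rX) (Reg rN)"
  let ?p = "Seq code_begin (Seq (While (Op Less (Reg rV) (Reg rn)) (code_vertex c)) code_end)"
  let ?T = "cost code_begin + (n * (4 + cost (code_vertex c)) + 4 + cost code_end)"
  have "runs B (While ?e ?p) \<sigma> ((N - fst \<sigma> rX) * (work ?e + 1 + ?T) + (work ?e + 1))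
      (\<lambda>\<tau>. ?J \<tau> \<and> val ?e \<tau> = 0)"
  proof (rule runs_While)
    fix \<sigma> assume J: "?J \<sigma>"
    show "fits B ?e \<sigma>"
      using J by (intro fits_piece) (auto simp: program_def tabulate_def)
    assume "val ?e \<sigma> \<noteq> 0"
    moreover obtain x qs where x: "tabulated x qs \<sigma>"
      using J by blast
    ultimately have less: "x < N" "fst \<sigma> rX = x"
      by (auto simp: tabulated_def ready_def split: if_splits)
    have "runs B ?p \<sigma> ?T (\<lambda>\<tau>. bounded X \<tau> \<and> (\<exists>qs'. tabulated (Suc x) qs' \<tau>))"
      by (rule runs_Seq[OF code_begin_correct[OF _ x]], use J in blast,
          rule runs_Seq[OF scan_correct], blast, blast, rule code_end_correct) (use less in auto)
    then show "runs B ?p \<sigma> ?T (\<lambda>\<tau>. ?J \<tau> \<and> N - fst \<tau> rX < N - fst \<sigma> rX)"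
      using less by (elim runs_mono) (auto simp: tabulated_def)
  qed (use assms in blast)
  then show ?thesis
    unfolding tabulate_def
  proof (rule runs_mono)
    show "(N - fst \<sigma> rX) * (work ?e + 1 + ?T) + (work ?e + 1) \<le> N * (4 + ?T) + 4"
      using assms by (simp add: tabulated_def)
    fix \<tau> assume *: "?J \<tau> \<and> val ?e \<tau> = 0"
    then obtain x qs where x: "tabulated x qs \<tau>"
      by blast
    then have "x = N"
      using * by (auto simp: tabulated_def ready_def split: if_splits)
    with x show "bounded X \<tau> \<and> (\<exists>qs. tabulated N qs \<tau>)"
      using * by blast
  qed
qed

section \<open>Breadth-first search on the codes\<close>

definition reachable :: "nat set" where
  "reachable = {y. \<exists>x<N. part x = S \<inter> K \<and> adj\<^sup>*\<^sup>* x y}"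

definition candidate :: "nat \<Rightarrow> nat \<Rightarrow> nat \<Rightarrow> bool" where
  "candidate x i w \<longleftrightarrow> w = n \<and> k < weight x \<or> dg x i = n \<and> k < weight (upd x i w)"

text \<open>The first \<open>a\<close> entries of the queue \<open>qs\<close> have been removed, and the neighbours of the first \<open>b\<close>
  entries are visited.\<close>

definition searched :: "nat \<Rightarrow> nat \<Rightarrow> nat list \<Rightarrow> state \<Rightarrow> bool" where
  "searched b a qs \<sigma> \<longleftrightarrow> ready \<sigma> \<and> table (snd \<sigma>) N qs \<and> fst \<sigma> rTail = length qs \<and> fst \<sigma> rHead = a \<and>
     a \<le> length qs \<and> {y. y < N \<and> part y = S \<inter> K} \<subseteq> set qs \<and> set qs \<subseteq> reachable \<and>
     (\<forall>j<b. \<forall>y. adj (qs ! j) y \<longrightarrow> y \<in> set qs) \<and>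
     fst \<sigma> rAns = of_bool (\<exists>j<a. part (qs ! j) = S' \<inter> K)"

text \<open>Entry \<open>a\<close> is being processed: digit values below \<open>w\<close> are done
  at all positions, the value \<open>w\<close> at positions below \<open>j\<close>. The head has
  already advanced, hence \<open>Suc a\<close>.\<close>

definition expanded :: "nat \<Rightarrow> nat list \<Rightarrow> nat \<Rightarrow> nat \<Rightarrow> state \<Rightarrow> bool" where
  "expanded a qs w j \<sigma> \<longleftrightarrow> searched a (Suc a) qs \<sigma> \<and> fst \<sigma> rX = qs ! a \<and> fst \<sigma> rW = w \<and> w \<le> Suc n \<and>
     (\<forall>w'<w. \<forall>i<c. candidate (qs ! a) i w' \<longrightarrow> upd (qs ! a) i w' \<in> set qs) \<and>
     (\<forall>i<j. candidate (qs ! a) i w \<longrightarrow> upd (qs ! a) i w \<in> set qs)"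

lemma adj_iff_candidate: "adj x y \<longleftrightarrow> (\<exists>i<c. \<exists>w\<le>n. y = upd x i w \<and> candidate x i w)"
  unfolding adj_def candidate_def by blast

lemma reachable_step: "x \<in> reachable \<Longrightarrow> adj x y \<Longrightarrow> y \<in> reachable"
  unfolding reachable_def by (auto intro: rtranclp.rtrancl_into_rtrancl)

lemma push_correct:
  assumes "expanded a qs w i \<sigma>" "i < c" "w \<le> n"
  shows "stores_le X (push i) \<sigma> \<and> (\<exists>qs'. expanded a qs' w (Suc i) (sem (push i) \<sigma>))"
proof -
  define x y where "x = qs ! a" and "y = upd x i w"
  have se: "searched a (Suc a) qs \<sigma>" and rX: "fst \<sigma> rX = x" and rW: "fst \<sigma> rW = w"
    using assms by (auto simp: expanded_def x_def)
  then have a: "a < length qs" and ready: "ready \<sigma>" and tab: "table (snd \<sigma>) N qs"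
    and tail: "fst \<sigma> rTail = length qs" and reach: "set qs \<subseteq> reachable"
    by (auto simp: searched_def)
  have x: "x \<in> set qs" "x < N"
    using a tab by (auto simp: x_def table_def dest: nth_mem)
  have y: "y < N"
    using x assms by (auto simp: y_def intro: upd_less)
  have regs: "fst \<sigma> rP = P" "fst \<sigma> rM = Suc n" "fst \<sigma> rn = n"
    using ready by (auto simp: ready_def)
  have mem: "snd \<sigma> (cell P y 2) = of_bool (y \<in> set qs)" "snd \<sigma> (cell P y 0) = of_bool (k < weight y)"
      "snd \<sigma> (cell P x 0) = of_bool (k < weight x)"
    using tab x y by (auto simp: table_def)
  have val: "x - digit (Suc n) x i * Suc n ^ i + w * Suc n ^ i = y"
    by (simp add: y_def set_digit_def)
  note simps = push_def regs rX rW tail val[simplified] mem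
  have cand: "candidate x i w \<longleftrightarrow> w = n \<and> k < weight x \<or> dg x i = n \<and> k < weight y"
    by (simp add: candidate_def y_def)
  show ?thesis
  proof (cases "y \<notin> set qs \<and> candidate x i w")
    case True
    have tab': "table ((snd \<sigma>)(cell P (length qs) 3 := y, cell P y 2 := 1)) N (qs @ [y])"
      using True by (intro table_push[OF tab y]) auto
    have sem: "snd (sem (push i) \<sigma>) = (snd \<sigma>)(cell P (length qs) 3 := y, cell P y 2 := 1)"
        "fst (sem (push i) \<sigma>) = (fst \<sigma>)(rY := y, rTail := Suc (length qs))"
      using True by (auto simp: simps cand)
    \<comment> \<open>The extended queue is still distinct, so the tail pointer never exceeds
      \<open>N\<close>.\<close>
    have "Suc (length qs) \<le> N"
      using table_length_le[OF tab'] by simp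
    then have "stores_le X (push i) \<sigma>"
      using True y X_bounds by (auto simp: simps cand)
    moreover have "y \<in> reachable"
      using True x reach assms reachable_step[of x y] by (auto simp: adj_iff_candidate y_def)
    \<comment> \<open>Appending leaves the earlier entries at their positions and only enlarges the
      visited set.\<close>
    then have "searched a (Suc a) (qs @ [y]) (sem (push i) \<sigma>)"
      using se tab' a unfolding searched_def ready_def
      by (auto simp: sem nth_append cell_neq_input less_Suc_eq)
    then have "expanded a (qs @ [y]) w (Suc i) (sem (push i) \<sigma>)"
      using assms a unfolding expanded_def
      by (auto simp: sem nth_append less_Suc_eq y_def x_def)
    ultimately show ?thesis
      by blast
  next
    case False
    have sem: "snd (sem (push i) \<sigma>) = snd \<sigma>" "fst (sem (push i) \<sigma>) = (fst \<sigma>)(rY := y)"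
      using False by (auto simp: simps cand)
    have "stores_le X (push i) \<sigma>"
      using False y X_bounds by (auto simp: simps cand)
    moreover have "searched a (Suc a) qs (sem (push i) \<sigma>)"
      using se unfolding searched_def ready_def by (simp add: sem)
    then have "expanded a qs w (Suc i) (sem (push i) \<sigma>)"
      using assms False unfolding expanded_def
      by (auto simp: sem less_Suc_eq y_def x_def)
    ultimately show ?thesis
      by blast
  qed
qed

lemma push_all_correct:
  assumes "expanded a qs w 0 \<sigma>" "j \<le> c" "w \<le> n"
  shows "stores_le X (push_all j) \<sigma> \<and> (\<exists>qs'. expanded a qs' w j (sem (push_all j) \<sigma>))"
  using assms(2)
proof (induction j)
  case (Suc j)
  then show ?case
    using push_correct[of a _ w j "sem (push_all j) \<sigma>"] assms(3) by fastforce
qed (use assms in auto)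

lemma push_row_correct:
  assumes "bounded X \<sigma>" "expanded a qs w 0 \<sigma>" "w \<le> n"
  shows "runs B (push_row c) \<sigma> (cost (push_row c))
    (\<lambda>\<tau>. bounded X \<tau> \<and> (\<exists>qs'. expanded a qs' (Suc w) 0 \<tau>))"
proof (rule runs_piece)
  obtain qs' where qs': "stores_le X (push_all c) \<sigma>" "expanded a qs' w c (sem (push_all c) \<sigma>)"
    using push_all_correct[OF assms(2) order_refl assms(3)] by blast
  then show "stores_le X (push_row c) \<sigma>"
    using X_bounds assms(3) by (simp add: push_row_def expanded_def)
  have "expanded a qs' (Suc w) 0 (sem (push_row c) \<sigma>)"
    using qs'(2) assms(3)
    by (auto simp: push_row_def expanded_def searched_def ready_def less_Suc_eq)
  then show "\<exists>qs'. expanded a qs' (Suc w) 0 (sem (push_row c) \<sigma>)" ..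
  show "prog_consts_le X (push_row c)"
    using consts_le_program[OF X_bounds(4), of c] by (simp add: program_def search_def)
qed (use assms in \<open>simp_all add: program_def search_def push_row_def\<close>)

lemma visit_begin_correct:
  assumes "bounded X \<sigma>" "searched a a qs \<sigma>" "a < length qs"
  shows "runs B visit_begin \<sigma> (cost visit_begin) (\<lambda>\<tau>. bounded X \<tau> \<and> expanded a qs 0 0 \<tau>)"
proof (rule runs_piece)
  have regs: "fst \<sigma> rP = P" "fst \<sigma> rHead = a"
    and tab: "table (snd \<sigma>) N qs" and ans: "fst \<sigma> rAns = of_bool (\<exists>j<a. part (qs ! j) = S' \<inter> K)"
    using assms by (auto simp: searched_def ready_def)
  have "qs ! a \<in> set qs"
    using assms(3) by simp
  then have x: "qs ! a < N"
    using tab by (auto simp: table_def)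
  have mem: "snd \<sigma> (cell P a 3) = qs ! a" "snd \<sigma> (cell P (qs ! a) (Suc 0)) = of_bool (part (qs ! a) = S' \<inter> K)"
    using tab x assms(3) by (auto simp: table_def)
  have "a < N"
    using table_length_le[OF tab] assms(3) by simp
  then show "stores_le X visit_begin \<sigma>"
    using X_bounds x by (simp add: visit_begin_def regs mem)
  show "expanded a qs 0 0 (sem visit_begin \<sigma>)"
    using assms
    by (auto simp: visit_begin_def regs mem expanded_def searched_def ready_def less_Suc_eq)
  show "prog_consts_le X visit_begin"
    using X_bounds by (simp add: visit_begin_def cell_expr_def)
qed (use assms in \<open>simp_all add: program_def search_def visit_begin_def\<close>)

lemma expand_correct:
  assumes "bounded X \<sigma>" "expanded a qs 0 0 \<sigma>"
  shows "runs B (While (Op Less (Reg rW) (Reg rM)) (push_row c)) \<sigma>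
    (Suc n * (4 + cost (push_row c)) + 4) (\<lambda>\<tau>. bounded X \<tau> \<and> (\<exists>qs'. searched (Suc a) (Suc a) qs' \<tau>))"
proof -
  let ?J = "\<lambda>\<sigma>. bounded X \<sigma> \<and> (\<exists>qs w. expanded a qs w 0 \<sigma>)"
  let ?e = "Op Less (Reg rW) (Reg rM)"
  have "runs B (While ?e (push_row c)) \<sigma>
      ((Suc n - fst \<sigma> rW) * (work ?e + 1 + cost (push_row c)) + (work ?e + 1))
      (\<lambda>\<tau>. ?J \<tau> \<and> val ?e \<tau> = 0)"
  proof (rule runs_While)
    fix \<sigma> assume J: "?J \<sigma>"
    show "fits B ?e \<sigma>"
      using J by (intro fits_piece) (auto simp: program_def search_def)
    assume "val ?e \<sigma> \<noteq> 0"
    moreover obtain qs w where w: "expanded a qs w 0 \<sigma>"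
      using J by blast
    ultimately have less: "w \<le> n" "fst \<sigma> rW = w"
      by (auto simp: expanded_def searched_def ready_def split: if_splits)
    have "runs B (push_row c) \<sigma> (cost (push_row c))
        (\<lambda>\<tau>. bounded X \<tau> \<and> (\<exists>qs'. expanded a qs' (Suc w) 0 \<tau>))"
      using push_row_correct J w less by blast
    then show "runs B (push_row c) \<sigma> (cost (push_row c))
        (\<lambda>\<tau>. ?J \<tau> \<and> Suc n - fst \<tau> rW < Suc n - fst \<sigma> rW)"
    proof (rule runs_mono[OF _ order_refl])
      fix \<tau> assume *: "bounded X \<tau> \<and> (\<exists>qs'. expanded a qs' (Suc w) 0 \<tau>)"
      then have "fst \<tau> rW = Suc w"
        by (auto simp: expanded_def)
      then show "?J \<tau> \<and> Suc n - fst \<tau> rW < Suc n - fst \<sigma> rW"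
        using * less by auto
    qed
  qed (use assms in blast)
  then show ?thesis
  proof (rule runs_mono)
    show "(Suc n - fst \<sigma> rW) * (work ?e + 1 + cost (push_row c)) + (work ?e + 1)
        \<le> Suc n * (4 + cost (push_row c)) + 4"
      using assms by (simp add: expanded_def algebra_simps)
    fix \<tau> assume *: "?J \<tau> \<and> val ?e \<tau> = 0"
    then obtain qs w where w: "expanded a qs w 0 \<tau>"
      by blast
    then have "w = Suc n"
      using * by (auto simp: expanded_def searched_def ready_def split: if_splits)
    \<comment> \<open>The values 0 to \<open>n\<close> at all positions exhaust the
      neighbours.\<close>
    then have "y \<in> set qs" if "adj (qs ! a) y" for y
      using that w by (auto simp: expanded_def adj_iff_candidate less_Suc_eq_le)
    with w have "searched (Suc a) (Suc a) qs \<tau>"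
      by (auto simp: expanded_def searched_def less_Suc_eq)
    then show "bounded X \<tau> \<and> (\<exists>qs'. searched (Suc a) (Suc a) qs' \<tau>)"
      using * by blast
  qed
qed

lemma search_correct:
  assumes "bounded X \<sigma>" "tabulated N qs \<sigma>"
  shows "runs B (search c) \<sigma> (N * (4 + (cost visit_begin + (Suc n * (4 + cost (push_row c)) + 4))) + 4)
    (\<lambda>\<tau>. \<exists>qs. searched (length qs) (length qs) qs \<tau>)"
proof -
  let ?J = "\<lambda>\<sigma>. bounded X \<sigma> \<and> (\<exists>a qs. searched a a qs \<sigma>)"
  let ?e = "Op Less (Reg rHead) (Reg rTail)"
  let ?p = "Seq visit_begin (While (Op Less (Reg rW) (Reg rM)) (push_row c))"
  let ?T = "cost visit_begin + (Suc n * (4 + cost (push_row c)) + 4)"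
  have "runs B (While ?e ?p) \<sigma> ((N - fst \<sigma> rHead) * (work ?e + 1 + ?T) + (work ?e + 1))
      (\<lambda>\<tau>. ?J \<tau> \<and> val ?e \<tau> = 0)"
  proof (rule runs_While)
    have "set qs \<subseteq> reachable"
      using assms(2) by (auto simp: tabulated_def reachable_def)
    then have "searched 0 0 qs \<sigma>"
      using assms(2) by (simp add: tabulated_def searched_def)
    then show "?J \<sigma>"
      using assms(1) by blast
    fix \<sigma> assume J: "?J \<sigma>"
    show "fits B ?e \<sigma>"
      using J by (intro fits_piece) (auto simp: program_def search_def)
    assume "val ?e \<sigma> \<noteq> 0"
    moreover obtain a qs where a: "searched a a qs \<sigma>"
      using J by blast
    ultimately have less: "a < length qs" "fst \<sigma> rHead = a"
      by (auto simp: searched_def split: if_splits)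
    \<comment> \<open>Every iteration removes one of at most \<open>N\<close> distinct entries,
      which makes \<open>N - fst \<sigma> rHead\<close> decrease.\<close>
    have "a < N"
      using less a table_length_le[of "snd \<sigma>" N qs] by (auto simp: searched_def)
    have "runs B ?p \<sigma> ?T (\<lambda>\<tau>. bounded X \<tau> \<and> (\<exists>qs'. searched (Suc a) (Suc a) qs' \<tau>))"
      by (rule runs_Seq[OF visit_begin_correct[OF _ a less(1)]], use J in blast,
          rule expand_correct) auto
    then show "runs B ?p \<sigma> ?T (\<lambda>\<tau>. ?J \<tau> \<and> N - fst \<tau> rHead < N - fst \<sigma> rHead)"
    proof (rule runs_mono[OF _ order_refl])
      fix \<tau> assume *: "bounded X \<tau> \<and> (\<exists>qs'. searched (Suc a) (Suc a) qs' \<tau>)"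
      then have "fst \<tau> rHead = Suc a"
        by (auto simp: searched_def)
      then show "?J \<tau> \<and> N - fst \<tau> rHead < N - fst \<sigma> rHead"
        using * less \<open>a < N\<close> by auto
    qed
  qed
  then show ?thesis
    unfolding search_def
  proof (rule runs_mono)
    show "(N - fst \<sigma> rHead) * (work ?e + 1 + ?T) + (work ?e + 1) \<le> N * (4 + ?T) + 4"
      using assms by (simp add: tabulated_def)
    fix \<tau> assume *: "?J \<tau> \<and> val ?e \<tau> = 0"
    then obtain a qs where a: "searched a a qs \<tau>"
      by blast
    then have "a = length qs"
      using * by (auto simp: searched_def split: if_splits)
    with a show "\<exists>qs. searched (length qs) (length qs) qs \<tau>"
      by blast
  qed
qed

text \<open>The final queue contains all starting codes, only reachable ones, and is closed under
  \<open>adj\<close>; hence it is exactly \<open>reachable\<close>.\<close>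

lemma search_result:
  assumes "searched (length qs) (length qs) qs \<sigma>"
  shows "fst \<sigma> 0 = of_bool (\<exists>Ss. tar_sequence c k (K \<union> I) E S S' Ss)"
proof -
  have start: "{y. y < N \<and> part y = S \<inter> K} \<subseteq> set qs" and sub: "set qs \<subseteq> reachable"
    and closed: "\<And>j y. j < length qs \<Longrightarrow> adj (qs ! j) y \<Longrightarrow> y \<in> set qs"
    and "fst \<sigma> 0 = of_bool (\<exists>j<length qs. part (qs ! j) = S' \<inter> K)"
    using assms by (simp_all add: searched_def)
  moreover have "(\<exists>j<length qs. part (qs ! j) = S' \<inter> K) \<longleftrightarrow> (\<exists>x\<in>set qs. part x = S' \<inter> K)"
    by (metis in_set_conv_nth)
  ultimately have ans: "fst \<sigma> 0 = of_bool (\<exists>x\<in>set qs. part x = S' \<inter> K)"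
    by simp
  have "y \<in> set qs" if "adj\<^sup>*\<^sup>* x y" "x \<in> set qs" for x y
    using that by (induction rule: rtranclp_induct) (auto simp: in_set_conv_nth dest: closed)
  then have "set qs = reachable"
    using start sub by (auto simp: reachable_def)
  then show ?thesis
    unfolding ans tar_sequence_iff_connected[OF colorable_S]
      connected_iff_codes[OF colorable_S k_le_S colorable_S' k_le_S']
    by (auto simp: reachable_def)
qed

lemma program_correct:
  "answers_within B (program c) (encode_instance n k K E S S') (time c n)
    (\<exists>Ss. tar_sequence c k (K \<union> I) E S S' Ss)"
proof -
  have "runs B (program c) (initial_state (encode_instance n k K E S S')) (time c n)
      (\<lambda>\<tau>. \<exists>qs. searched (length qs) (length qs) qs \<tau>)"
    unfolding program_def time_def
    by (rule runs_Seq[OF load_input_correct], rule runs_Seq[OF tabulate_correct], blast, blast)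
      (use search_correct in blast)
  then show ?thesis
    unfolding runs_def answers_within_def using search_result by blast
qed

end

section \<open>Asymptotic running time and conclusion\<close>

lemma time_bigo: "(\<lambda>n. real (time c n)) \<in> O(\<lambda>n. real n ^ (c + 1))"
proof -
  \<comment> \<open>The summand 32 collects the eight loop tests of cost 4; every term of
    \<open>time\<close> carries at most \<open>c + 1\<close> factors of size
    \<open>Suc n\<close>.\<close>
  define C where "C = cost (load_input c) + 32 + cost code_begin + cost (code_vertex c) +
    cost code_end + cost visit_begin + cost (push_row c)"
  have "time c n \<le> C * Suc n ^ (c + 1)" for n
  proof -
    have *: "a \<le> a * Suc n ^ (c + 1)" "Suc n ^ c * a \<le> a * Suc n ^ (c + 1)"
        "Suc n ^ c * (n * a) \<le> a * Suc n ^ (c + 1)" "Suc n ^ c * (Suc n * a) = a * Suc n ^ (c + 1)" for a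
    proof -
      have "a * 1 \<le> a * Suc n ^ (c + 1)"
        by (intro mult_le_mono2 one_le_power) simp
      then show "a \<le> a * Suc n ^ (c + 1)"
        by simp
    qed (simp_all add: algebra_simps)
    show ?thesis
      using *[of 4] *[of "cost (load_input c)"] *[of "cost code_begin"] *[of "cost (code_vertex c)"]
        *[of "cost code_end"] *[of "cost visit_begin"] *[of "cost (push_row c)"]
      unfolding time_def C_def distrib_left distrib_right by linarith
  qed
  then have le: "real (time c n) \<le> real C * real (Suc n) ^ (c + 1)" for n
    by (metis of_nat_le_iff of_nat_mult of_nat_power)
  \<comment> \<open>For positive \<open>n\<close>, \<open>Suc n\<close> is at most
    \<open>2 * n\<close>, which costs the factor \<open>2 ^ (c + 1)\<close>.\<close>
  have "real (time c n) \<le> real C * 2 ^ (c + 1) * real n ^ (c + 1)" if "1 \<le> n" for n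
  proof -
    note le
    also have "real C * real (Suc n) ^ (c + 1) \<le> real C * (2 * real n) ^ (c + 1)"
      using that by (intro mult_left_mono power_mono) auto
    also have "\<dots> = real C * 2 ^ (c + 1) * real n ^ (c + 1)"
      by (simp add: power_mult_distrib)
    finally show ?thesis .
  qed
  then show ?thesis
    by (intro bigoI[of _ "real C * 2 ^ (c + 1)"] eventually_at_top_linorderI[of 1]) auto
qed

theorem theorem20:
  fixes c :: nat
  assumes "1 \<le> c"
  shows "\<exists>(p :: com) (d :: nat) (T :: nat \<Rightarrow> nat).
    (\<lambda>n. real (T n)) \<in> O(\<lambda>n. real n ^ (c + 1)) \<and>
    (\<forall>(n :: nat) (K :: nat set) (I :: nat set) (E :: nat rel) (k :: nat) (S :: nat set) (S' :: nat set).
       split_graph K I E \<and> K \<union> I = {..<n} \<and>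
       colorable_set c (K \<union> I) E S \<and> k \<le> card S \<and>
       colorable_set c (K \<union> I) E S' \<and> k \<le> card S' \<longrightarrow>
       answers_within ((n + 2) ^ d) p (encode_instance n k K E S S') (T n)
         (\<exists>Ss. tar_sequence c k (K \<union> I) E S S' Ss))"
proof (intro exI conjI allI impI)
  show "(\<lambda>n. real (time c n)) \<in> O(\<lambda>n. real n ^ (c + 1))"
    by (rule time_bigo)
  fix n k :: nat and K I :: "nat set" and E :: "nat rel" and S S' :: "nat set"
  assume inst: "split_graph K I E \<and> K \<union> I = {..<n} \<and>
       colorable_set c (K \<union> I) E S \<and> k \<le> card S \<and>
       colorable_set c (K \<union> I) E S' \<and> k \<le> card S'"
  interpret tar_input c k K I E n S S'
    by unfold_locales (use inst assms in blast)+
  \<comment> \<open>The exponent \<open>d\<close> multiplies the exponents of \<open>X\<close> and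
    \<open>B\<close>, so the word bound is \<open>B\<close> itself.\<close>
  show "answers_within ((n + 2) ^ ((c + 2) * cost (program c))) (program c)
      (encode_instance n k K E S S') (time c n) (\<exists>Ss. tar_sequence c k (K \<union> I) E S S' Ss)"
    using program_correct by (simp only: B_def X_def power_mult)
qed

end
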